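(* Let $\{f_\kappa\}$ be a family, indexed by the coupling strength $\kappa>0$, of solutions of the kinetic Schrödinger-Lohe equation without Hartree term $$\partial_tf_\kappa+\operatorname{div}_\phi\big(f_\kappa Y^f\big)+\frac{\kappa}{2}\operatorname{div}_\phi\Big(f_\kappa\int_{\mathbf S\mathfrak H\times C(\mathbb T^d)}\big(\tilde\phi-\langle\phi|\tilde\phi\rangle\phi\big)f_\kappa(t,d\tilde\phi\,d\tilde V)\Big)=0$$ with initial data $f_\kappa^0\in\mathcal P(\mathbf S\mathfrak H\times C(\mathbb T^d))$. Let $$P_\infty:=\sup\{\|V\|_{L^\infty}:(\phi,V)\in\operatorname{supp}f_\kappa^0\},$$ $$\alpha:=\frac1\hbar\sup\{\|V_1-V_2\|_{L^\infty}:(\phi_1,V_1),(\phi_2,V_2)\in\operatorname{supp}f_\kappa^0\}$$ be bounds independent of $\kappa$ (that is, each supremum is also taken over all $\kappa$ in the family), and assume $$P_\infty<\infty,\qquad\alpha<\infty,\qquad\mathcal D[f_\kappa^0]<\xi_2(\alpha/\kappa)\ \text{ for all }\kappa>64\alpha ,$$ where, for $\eta\in[0,\tfrac1{64})$, $\xi_2(\eta)$ is the larger root of $z^2-\tfrac14z+\eta=0$. Then practical synchronization holds: $$\lim_{\kappa\to\infty}\ \limsup_{t\to\infty}\ \mathcal D[f_\kappa(t)]=0 .$$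
   Context: $\mathbb T^d=\mathbb R^d/\mathbb Z^d$; $\mathfrak H=L^2(\mathbb T^d)$ (complex-valued) with $\langle\psi|\chi\rangle=\int_{\mathbb T^d}\psi\,\overline{\chi}\,dx$ and norm $\|\cdot\|_{\mathfrak H}$; $\mathbf S\mathfrak H$ is its unit sphere. $C(\mathbb T^d)$ is the space of (real-valued) continuous functions with norm $\|\cdot\|_{L^\infty}$. $\mathcal P(Z)$ is the set of Borel probability measures on $Z$. $\hbar>0$ is fixed, $U(t)=e^{it\Delta/2}$, and (the Hartree kernel being $\omega\equiv0$) $$Y^f(t,\phi,V)=\tfrac1{i\hbar}U(\hbar t)^*\,V\,U(\hbar t)\phi .$$ Solutions are Lagrangian: $f_\kappa(t)$ is the push-forward of $f_\kappa^0$ under $(\phi^0,V^0)\mapsto(\phi(t),V^0)$, where $\phi$ solves $$\partial_t\phi=Y^f(t,\phi,V^0)+\frac{\kappa}{2}\int_{\mathbf S\mathfrak H}\big(\tilde\phi-\langle\phi|\tilde\phi\rangle\phi\big)\rho_{f_\kappa}(t,d\tilde\phi),\quad\phi(0)=\phi^0,$$ and $\rho_{f}(t)$ denotes the push-forward of $f(t)$ under $(\phi,V)\mapsto\phi$. (Since $V$ is not transported, the $V$-support does not depend on $t$.) $\mathcal D[f(t)]:=\sup\{\|\phi_1-\phi_2\|_{\mathfrak H}:\phi_1,\phi_2\in\operatorname{supp}\rho_f(t)\}$. *)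

theory Defs
  imports "HOL-Probability.Probability_Measure"
begin

section \<open>The torus\<close>

definition lattice_equiv :: "real ^ 'd \<Rightarrow> real ^ 'd \<Rightarrow> bool"
  where "lattice_equiv x y \<longleftrightarrow> (\<forall>i. x $ i - y $ i \<in> \<int>)"

lemma equivp_lattice_equiv: "equivp lattice_equiv"
proof (rule equivpI)
  show "reflp lattice_equiv" by (simp add: reflp_def lattice_equiv_def)
  show "symp lattice_equiv"
    unfolding symp_def lattice_equiv_def by (metis Ints_minus minus_diff_eq)
  show "transp lattice_equiv"
  proof (rule transpI)
    fix x y z :: "real ^ 'd" assume *: "lattice_equiv x y" "lattice_equiv y z"
    have "x $ i - z $ i = (x $ i - y $ i) + (y $ i - z $ i)" for i by simp
    with * show "lattice_equiv x z" unfolding lattice_equiv_def by (metis Ints_add)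
  qed
qed

quotient_type 'd torus = "real ^ 'd" / lattice_equiv
  morphisms rep_torus torus_proj
  by (rule equivp_lattice_equiv)

lemma torus_proj_eq_iff: "torus_proj x = torus_proj y \<longleftrightarrow> lattice_equiv x y"
  by (rule torus.abs_eq_iff)

lemma torus_proj_rep [simp]: "torus_proj (rep_torus t) = t"
  by (meson Quotient_torus Quotient_abs_rep)

instantiation torus :: (finite) topological_space
begin

definition open_torus :: "'a torus set \<Rightarrow> bool"
  where "open_torus U \<longleftrightarrow> open (torus_proj -` U)"

instance
  by standard (auto simp: open_torus_def vimage_Union intro: open_UN)

end

lemma continuous_on_torus_proj: "continuous_on UNIV torus_proj"
  by (simp add: continuous_on_open_vimage open_torus_def)

lemma open_map_torus_proj:
  assumes "open U" shows "open (torus_proj ` U)"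
proof -
  have "torus_proj -` torus_proj ` U = (\<Union>k\<in>{k. \<forall>i. k $ i \<in> \<int>}. (\<lambda>x. k + x) ` U)"
  proof (intro set_eqI iffI)
    fix x assume "x \<in> torus_proj -` torus_proj ` U"
    then obtain y where y: "y \<in> U" "lattice_equiv x y" by (auto simp: torus_proj_eq_iff)
    then have "\<forall>i. (x - y) $ i \<in> \<int>" "x = (x - y) + y" by (auto simp: lattice_equiv_def)
    then show "x \<in> (\<Union>k\<in>{k. \<forall>i. k $ i \<in> \<int>}. (\<lambda>x. k + x) ` U)" using y by blast
  next
    fix x assume "x \<in> (\<Union>k\<in>{k. \<forall>i. k $ i \<in> \<int>}. (\<lambda>x. k + x) ` U)"
    then obtain k y where "\<forall>i. k $ i \<in> \<int>" "y \<in> U" "x = k + y" by auto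
    then show "x \<in> torus_proj -` torus_proj ` U"
      by (auto simp: torus_proj_eq_iff lattice_equiv_def intro!: image_eqI[of _ _ y])
  qed
  moreover have "open (\<Union>k\<in>{k. \<forall>i. k $ i \<in> \<int>}. (\<lambda>x. k + x) ` U)"
    using assms by (intro open_UN ballI open_translation)
  ultimately show ?thesis by (simp add: open_torus_def)
qed

lemma continuous_on_torus_lift:
  assumes "continuous_on UNIV (\<lambda>x. f (torus_proj x))"
  shows "continuous_on UNIV f"
proof -
  have "(\<lambda>x. f (torus_proj x)) -` B = torus_proj -` (f -` B)" for B by auto
  with assms show ?thesis
    by (simp add: continuous_on_open_vimage open_torus_def)
qed

instance torus :: (finite) second_countable_topology
proof
  obtain B :: "(real ^ 'a) set set" where B: "countable B" "topological_basis B"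
    using ex_countable_basis by blast
  let ?B = "(`) torus_proj ` B"
  have "topological_basis ?B"
  proof (rule topological_basisI)
    fix U assume "U \<in> ?B" then show "open U"
      using B by (auto intro!: open_map_torus_proj topological_basis_open)
  next
    fix U :: "'a torus set" and t assume U: "open U" "t \<in> U"
    then have "open (torus_proj -` U)" "rep_torus t \<in> torus_proj -` U"
      by (auto simp: open_torus_def)
    then obtain V where V: "V \<in> B" "rep_torus t \<in> V" "V \<subseteq> torus_proj -` U"
      using B(2) topological_basisE by blast
    then have "t \<in> torus_proj ` V"
      by (metis image_eqI torus_proj_rep)
    with V show "\<exists>W\<in>?B. t \<in> W \<and> W \<subseteq> U" by blast
  qed
  with B show "\<exists>B::'a torus set set. countable B \<and> open = generate_topology B"
    by (metis countable_image topological_basis_imp_subbasis)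
qed

text \<open>Haar measure: the unit cube is a fundamental domain of the integer lattice.\<close>

definition torus_measure :: "('d::finite) torus measure"
  where "torus_measure = distr (restrict_space lborel {x. \<forall>i. 0 \<le> x $ i \<and> x $ i < 1}) borel torus_proj"

lemma space_torus_measure [simp]: "space torus_measure = UNIV"
  and sets_torus_measure [simp, measurable_cong]: "sets torus_measure = sets borel"
  by (simp_all add: torus_measure_def)

lemma borel_measurable_torus_proj [measurable]: "torus_proj \<in> borel_measurable borel"
  by (intro borel_measurable_continuous_onI continuous_on_torus_proj)

lemma emeasure_unit_cube: "emeasure lborel {x :: real ^ 'd. \<forall>i. 0 \<le> x $ i \<and> x $ i < 1} = 1"
proof -
  let ?C = "{x :: real ^ 'd. \<forall>i. 0 \<le> x $ i \<and> x $ i < 1}"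
  have C: "?C \<in> sets lborel"
  proof -
    have "?C = (\<Inter>i. {x. 0 \<le> x $ i} \<inter> {x. x $ i < 1})" by auto
    also have "\<dots> \<in> sets lborel" by measurable
    finally show ?thesis .
  qed
  have 1: "(1 :: real ^ 'd) \<bullet> b = 1" if "b \<in> Basis" for b
    using that by (auto simp: Basis_vec_def inner_axis)
  then have le: "(0 :: real ^ 'd) \<bullet> b \<le> 1 \<bullet> b" if "b \<in> Basis" for b
    using that by simp
  have p: "(\<Prod>b\<in>Basis. (1 - 0 :: real ^ 'd) \<bullet> b) = 1"
    by (intro prod.neutral ballI) (simp only: diff_0_right 1)
  have "emeasure lborel (box 0 1 :: (real ^ 'd) set) = 1"
    using emeasure_lborel_box[OF le] unfolding p by (simp only: ennreal_1)
  moreover have "emeasure lborel (box 0 1 :: (real ^ 'd) set) \<le> emeasure lborel ?C"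
    by (rule emeasure_mono) (use C in \<open>auto simp: mem_box_cart less_imp_le\<close>)
  ultimately have "1 \<le> emeasure lborel ?C" by simp
  moreover have "emeasure lborel (cbox 0 1 :: (real ^ 'd) set) = 1"
    using emeasure_lborel_cbox[OF le] unfolding p by (simp only: ennreal_1)
  moreover have "emeasure lborel ?C \<le> emeasure lborel (cbox 0 1 :: (real ^ 'd) set)"
    by (rule emeasure_mono) (auto simp: mem_box_cart less_imp_le)
  ultimately show ?thesis by (intro antisym) simp_all
qed

lemma finite_measure_torus: "emeasure (torus_measure :: ('d::finite) torus measure) UNIV = 1"
proof -
  let ?C = "{x :: real ^ 'd. \<forall>i. 0 \<le> x $ i \<and> x $ i < 1}"
  have "?C = (\<Inter>i. {x. 0 \<le> x $ i} \<inter> {x. x $ i < 1})" by auto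
  also have "\<dots> \<in> sets lborel" by measurable
  finally have C: "?C \<in> sets lborel" .
  have "torus_proj \<in> borel_measurable (restrict_space lborel ?C)"
    by (rule measurable_restrict_space1) simp
  then have "emeasure torus_measure (UNIV :: 'd torus set)
      = emeasure (restrict_space lborel ?C) (torus_proj -` UNIV \<inter> space (restrict_space lborel ?C))"
    unfolding torus_measure_def by (rule emeasure_distr) simp
  also have "torus_proj -` UNIV \<inter> space (restrict_space lborel ?C) = ?C"
    by (auto simp: space_restrict_space)
  also have "emeasure (restrict_space lborel ?C) ?C = emeasure lborel ?C"
    by (rule emeasure_restrict_space) (use C in auto)
  finally show ?thesis by (simp only: emeasure_unit_cube)
qed

interpretation torus_measure: finite_measure "torus_measure :: ('d::finite) torus measure"
  by (rule finite_measureI) (simp add: finite_measure_torus)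

lift_definition character :: "int ^ 'd \<Rightarrow> ('d::finite) torus \<Rightarrow> complex"
  is "\<lambda>k x. cis (2 * pi * (\<Sum>i\<in>UNIV. of_int (k $ i) * x $ i))"
proof -
  fix k :: "int ^ 'd" and x y :: "real ^ 'd"
  assume "lattice_equiv x y"
  then have "(\<Sum>i\<in>UNIV. of_int (k $ i) * (x $ i - y $ i)) \<in> \<int>"
    by (auto simp: lattice_equiv_def)
  then obtain n where n: "(\<Sum>i\<in>UNIV. of_int (k $ i) * (x $ i - y $ i)) = of_int n"
    by (auto elim: Ints_cases)
  have "(\<Sum>i\<in>UNIV. of_int (k $ i) * x $ i) = (\<Sum>i\<in>UNIV. of_int (k $ i) * y $ i) + of_int n"
    by (simp flip: n sum.distrib add: algebra_simps)
  then have "cis (2 * pi * (\<Sum>i\<in>UNIV. of_int (k $ i) * x $ i))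
      = cis (2 * pi * (\<Sum>i\<in>UNIV. of_int (k $ i) * y $ i)) * cis (2 * pi * of_int n)"
    by (simp only: cis_mult distrib_left)
  also have "cis (2 * pi * of_int n) = 1"
    by (rule cis_multiple_2pi) simp
  finally show "cis (2 * pi * (\<Sum>i\<in>UNIV. of_int (k $ i) * x $ i))
      = cis (2 * pi * (\<Sum>i\<in>UNIV. of_int (k $ i) * y $ i))"
    by (simp only: mult_1_right)
qed

lemma continuous_on_character: "continuous_on UNIV (character k)"
proof (rule continuous_on_torus_lift)
  show "continuous_on UNIV (\<lambda>x. character k (torus_proj x))"
    unfolding character.abs_eq
    by (intro continuous_on_cis continuous_on_mult_left continuous_on_sum continuous_on_component
        continuous_on_id)
qed

lemma norm_character [simp]: "norm (character k t) = 1"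
  by transfer simp

section \<open>The Hilbert space of square-integrable functions on the torus\<close>

definition square_integrable :: "(('d::finite) torus \<Rightarrow> complex) \<Rightarrow> bool"
  where "square_integrable f \<longleftrightarrow>
    f \<in> borel_measurable torus_measure \<and> integrable torus_measure (\<lambda>x. (cmod (f x))\<^sup>2)"

definition L2_rel :: "(('d::finite) torus \<Rightarrow> complex) \<Rightarrow> ('d torus \<Rightarrow> complex) \<Rightarrow> bool"
  where "L2_rel f g \<longleftrightarrow> square_integrable f \<and> square_integrable g \<and> (AE x in torus_measure. f x = g x)"

lemma square_integrable_measurable: "square_integrable f \<Longrightarrow> f \<in> borel_measurable torus_measure"
  and square_integrable_integrable:
    "square_integrable f \<Longrightarrow> integrable torus_measure (\<lambda>x. (cmod (f x))\<^sup>2)"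
  by (simp_all add: square_integrable_def)

lemma square_integrable_bound:
  assumes "f \<in> borel_measurable torus_measure" "integrable torus_measure g"
    and "\<And>x. (cmod (f x))\<^sup>2 \<le> g x"
  shows "square_integrable f"
  unfolding square_integrable_def
proof (intro conjI Bochner_Integration.integrable_bound[OF assms(2)] AE_I2)
  show "norm ((cmod (f x))\<^sup>2) \<le> norm (g x)" for x
    using assms(3)[of x] order_trans[OF _ assms(3)[of x], of 0] by simp
qed (use assms(1) in measurable)

lemma square_integrable_bounded:
  assumes "f \<in> borel_measurable torus_measure" "\<And>x. cmod (f x) \<le> B"
  shows "square_integrable f"
proof (rule square_integrable_bound[where g="\<lambda>_. B\<^sup>2"])
  show "(cmod (f x))\<^sup>2 \<le> B\<^sup>2" for x by (rule power_mono) (use assms(2)[of x] in auto)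
qed (use assms(1) in auto)

lemma square_integrable_mult_bounded:
  assumes f: "square_integrable f"
    and h: "h \<in> borel_measurable torus_measure" "\<And>x. cmod (h x) \<le> B"
  shows "square_integrable (\<lambda>x. h x * f x)"
proof (rule square_integrable_bound[where g="\<lambda>x. B\<^sup>2 * (cmod (f x))\<^sup>2"])
  show "(cmod (h x * f x))\<^sup>2 \<le> B\<^sup>2 * (cmod (f x))\<^sup>2" for x
    unfolding norm_mult power_mult_distrib
    by (intro mult_right_mono power_mono h(2)) auto
qed (use square_integrable_measurable[OF f] square_integrable_integrable[OF f] h(1) in
      \<open>auto intro!: borel_measurable_times\<close>)

lemma square_integrable_add:
  assumes f: "square_integrable f" and g: "square_integrable g"
  shows "square_integrable (\<lambda>x. f x + g x)"
proof (rule square_integrable_bound[where g="\<lambda>x. 2 * (cmod (f x))\<^sup>2 + 2 * (cmod (g x))\<^sup>2"])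
  show "(cmod (f x + g x))\<^sup>2 \<le> 2 * (cmod (f x))\<^sup>2 + 2 * (cmod (g x))\<^sup>2" for x
  proof -
    have "(cmod (f x + g x))\<^sup>2 \<le> (cmod (f x) + cmod (g x))\<^sup>2"
      by (intro power_mono norm_triangle_ineq) simp
    also have "\<dots> \<le> 2 * (cmod (f x))\<^sup>2 + 2 * (cmod (g x))\<^sup>2"
      using zero_le_power2[of "cmod (f x) - cmod (g x)"]
      by (simp add: power2_eq_square algebra_simps)
    finally show ?thesis .
  qed
qed (use square_integrable_measurable[OF f] square_integrable_measurable[OF g]
      square_integrable_integrable[OF f] square_integrable_integrable[OF g] in
      \<open>auto intro!: borel_measurable_add\<close>)

lemma square_integrable_const_mult: "square_integrable f \<Longrightarrow> square_integrable (\<lambda>x. c * f x)"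
  by (rule square_integrable_mult_bounded[where B="cmod c"]) auto

lemma square_integrable_minus:
  assumes "square_integrable f" shows "square_integrable (\<lambda>x. - f x)"
  using square_integrable_const_mult[OF assms, of "-1"] by simp

lemma integrable_mult_cnj:
  assumes f: "square_integrable f" and g: "square_integrable g"
  shows "integrable torus_measure (\<lambda>x. f x * cnj (g x))"
proof (rule Bochner_Integration.integrable_bound)
  show "integrable torus_measure (\<lambda>x. (cmod (f x))\<^sup>2 + (cmod (g x))\<^sup>2)"
    using f g by (simp add: square_integrable_def)
  show "(\<lambda>x. f x * cnj (g x)) \<in> borel_measurable torus_measure"
    using square_integrable_measurable[OF f] square_integrable_measurable[OF g]
    by (intro borel_measurable_times borel_measurable_continuous_on[OF _ square_integrable_measurable[OF g]])
      (auto intro: continuous_intros)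
  show "AE x in torus_measure. norm (f x * cnj (g x)) \<le> norm ((cmod (f x))\<^sup>2 + (cmod (g x))\<^sup>2)"
  proof (rule AE_I2)
    fix x
    have "0 \<le> cmod (f x) * cmod (g x)" by simp
    moreover have "0 \<le> (cmod (f x) - cmod (g x))\<^sup>2" by simp
    ultimately have "cmod (f x) * cmod (g x) \<le> (cmod (f x))\<^sup>2 + (cmod (g x))\<^sup>2"
      unfolding power2_diff by linarith
    then show "norm (f x * cnj (g x)) \<le> norm ((cmod (f x))\<^sup>2 + (cmod (g x))\<^sup>2)"
      by (simp add: norm_mult)
  qed
qed

lemma part_equivp_L2_rel: "part_equivp L2_rel"
proof (rule part_equivpI)
  show "\<exists>f :: 'a torus \<Rightarrow> complex. L2_rel f f"
    by (rule exI[of _ "\<lambda>_. 0"]) (simp add: L2_rel_def square_integrable_def)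
  show "symp (L2_rel :: ('a torus \<Rightarrow> complex) \<Rightarrow> _)"
    by (auto simp: symp_def L2_rel_def)
  show "transp (L2_rel :: ('a torus \<Rightarrow> complex) \<Rightarrow> _)"
    unfolding transp_def L2_rel_def by (auto elim: AE_mp)
qed

quotient_type 'd L2 = "('d::finite) torus \<Rightarrow> complex" / partial: L2_rel
  by (rule part_equivp_L2_rel)

text \<open>The inner product is linear in its first argument.\<close>

lift_definition L2_inner :: "('d::finite) L2 \<Rightarrow> 'd L2 \<Rightarrow> complex"
  is "\<lambda>f g. LINT x|torus_measure. f x * cnj (g x)"
proof -
  fix f f' g g' :: "'d torus \<Rightarrow> complex"
  assume fg: "L2_rel f f'" "L2_rel g g'"
  then have "AE x in torus_measure. f x * cnj (g x) = f' x * cnj (g' x)"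
    unfolding L2_rel_def by auto
  with fg show "(LINT x|torus_measure. f x * cnj (g x)) = (LINT x|torus_measure. f' x * cnj (g' x))"
    by (intro integral_cong_AE borel_measurable_integrable integrable_mult_cnj) (auto simp: L2_rel_def)
qed

lift_definition L2_scale :: "complex \<Rightarrow> ('d::finite) L2 \<Rightarrow> 'd L2"
  is "\<lambda>c f x. c * f x"
  by (auto simp: L2_rel_def intro: square_integrable_const_mult)

lemma borel_measurable_bcontfun:
  "(\<lambda>x. complex_of_real (apply_bcontfun V x)) \<in> borel_measurable (torus_measure :: ('d::finite) torus measure)"
proof -
  have "apply_bcontfun V \<in> borel_measurable (borel :: 'd torus measure)"
    by (intro borel_measurable_continuous_onI continuous_on_apply_bcontfun)
  then have "apply_bcontfun V \<in> borel_measurable (torus_measure :: 'd torus measure)"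
    by (simp cong: measurable_cong_sets)
  then show ?thesis by measurable
qed

text \<open>Since the torus is compact, its bounded continuous functions are all of its continuous
  functions, so \<^typ>\<open>'d torus \<Rightarrow>\<^sub>C real\<close> with its supremum norm is the space of potentials.\<close>

lifting_forget torus.lifting

lift_definition L2_potential :: "(('d::finite) torus \<Rightarrow>\<^sub>C real) \<Rightarrow> 'd L2 \<Rightarrow> 'd L2"
  is "\<lambda>V f x. complex_of_real (apply_bcontfun V x) * f x"
proof -
  fix V :: "'d torus \<Rightarrow>\<^sub>C real" and f g :: "'d torus \<Rightarrow> complex"
  assume fg: "L2_rel f g"
  have "cmod (complex_of_real (apply_bcontfun V x)) \<le> norm V" for x
    using norm_bounded[of V x] by simp
  with fg show "L2_rel (\<lambda>x. complex_of_real (apply_bcontfun V x) * f x)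
      (\<lambda>x. complex_of_real (apply_bcontfun V x) * g x)"
    by (auto simp: L2_rel_def intro!: square_integrable_mult_bounded borel_measurable_bcontfun)
qed

text \<open>The real inner product is the real part of \<^const>\<open>L2_inner\<close>, so that the norm is the usual
  one on the complex Hilbert space.\<close>

instantiation L2 :: (finite) real_inner
begin

lift_definition zero_L2 :: "'a L2" is "\<lambda>_. 0"
  by (auto simp: L2_rel_def intro: square_integrable_bounded[where B=0])

lift_definition plus_L2 :: "'a L2 \<Rightarrow> 'a L2 \<Rightarrow> 'a L2" is "\<lambda>f g x. f x + g x"
  by (auto simp: L2_rel_def intro!: square_integrable_add)

lift_definition uminus_L2 :: "'a L2 \<Rightarrow> 'a L2" is "\<lambda>f x. - f x"
  by (auto simp: L2_rel_def intro!: square_integrable_minus)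

definition minus_L2 :: "'a L2 \<Rightarrow> 'a L2 \<Rightarrow> 'a L2"
  where "minus_L2 \<psi> \<eta> = \<psi> + - \<eta>"

definition scaleR_L2 :: "real \<Rightarrow> 'a L2 \<Rightarrow> 'a L2"
  where "scaleR_L2 r \<psi> = L2_scale (complex_of_real r) \<psi>"

definition inner_L2 :: "'a L2 \<Rightarrow> 'a L2 \<Rightarrow> real"
  where "inner_L2 \<psi> \<eta> = Re (L2_inner \<psi> \<eta>)"

definition norm_L2 :: "'a L2 \<Rightarrow> real"
  where "norm_L2 \<psi> = sqrt (inner \<psi> \<psi>)"

definition sgn_L2 :: "'a L2 \<Rightarrow> 'a L2"
  where "sgn_L2 \<psi> = inverse (norm \<psi>) *\<^sub>R \<psi>"

definition dist_L2 :: "'a L2 \<Rightarrow> 'a L2 \<Rightarrow> real"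
  where "dist_L2 \<psi> \<eta> = norm (\<psi> - \<eta>)"

definition uniformity_L2 :: "('a L2 \<times> 'a L2) filter"
  where "uniformity_L2 = (INF e\<in>{0 <..}. principal {(\<psi>, \<eta>). dist \<psi> \<eta> < e})"

definition open_L2 :: "'a L2 set \<Rightarrow> bool"
  where "open_L2 S = (\<forall>\<psi>\<in>S. \<forall>\<^sub>F (\<psi>', \<eta>) in uniformity. \<psi>' = \<psi> \<longrightarrow> \<eta> \<in> S)"

instance
proof
  fix \<psi> \<eta> \<theta> :: "'a L2" and r s :: real
  show "\<psi> + \<eta> + \<theta> = \<psi> + (\<eta> + \<theta>)"
    by transfer (auto simp: L2_rel_def add.assoc intro!: square_integrable_add)
  show "\<psi> + \<eta> = \<eta> + \<psi>"
    by transfer (auto simp: L2_rel_def add.commute intro!: square_integrable_add)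
  show "0 + \<psi> = \<psi>"
    by transfer (auto simp: L2_rel_def)
  show "- \<psi> + \<psi> = 0"
    by transfer (auto simp: L2_rel_def intro: square_integrable_bounded[where B=0])
  show "\<psi> - \<eta> = \<psi> + - \<eta>" by (simp add: minus_L2_def)
  show "r *\<^sub>R (\<psi> + \<eta>) = r *\<^sub>R \<psi> + r *\<^sub>R \<eta>"
    unfolding scaleR_L2_def
    by transfer (auto simp: L2_rel_def distrib_left
        intro!: square_integrable_add square_integrable_const_mult)
  show "(r + s) *\<^sub>R \<psi> = r *\<^sub>R \<psi> + s *\<^sub>R \<psi>"
    unfolding scaleR_L2_def
    by transfer (auto simp: L2_rel_def distrib_right
        intro!: square_integrable_add square_integrable_const_mult)
  show "r *\<^sub>R s *\<^sub>R \<psi> = (r * s) *\<^sub>R \<psi>"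
    unfolding scaleR_L2_def
    by transfer (auto simp: L2_rel_def mult.assoc intro!: square_integrable_const_mult)
  show "1 *\<^sub>R \<psi> = \<psi>"
    unfolding scaleR_L2_def by transfer (auto simp: L2_rel_def)
  show "sgn \<psi> = inverse (norm \<psi>) *\<^sub>R \<psi>" by (simp add: sgn_L2_def)
  show "dist \<psi> \<eta> = norm (\<psi> - \<eta>)" by (simp add: dist_L2_def)
  show "(uniformity :: ('a L2 \<times> 'a L2) filter) = (INF e\<in>{0 <..}. principal {(\<psi>, \<eta>). dist \<psi> \<eta> < e})"
    by (simp add: uniformity_L2_def)
  show "open S = (\<forall>\<psi>\<in>S. \<forall>\<^sub>F (\<psi>', \<eta>) in uniformity. \<psi>' = \<psi> \<longrightarrow> \<eta> \<in> S)" for S :: "'a L2 set"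
    by (simp add: open_L2_def)
  show "norm \<psi> = sqrt (inner \<psi> \<psi>)" by (simp add: norm_L2_def)
  show "inner \<psi> \<eta> = inner \<eta> \<psi>"
    unfolding inner_L2_def
  proof transfer
    fix f g :: "'a torus \<Rightarrow> complex" assume "L2_rel f f" "L2_rel g g"
    have "(LINT x|torus_measure. g x * cnj (f x)) = (LINT x|torus_measure. cnj (f x * cnj (g x)))"
      by (simp add: mult.commute)
    also have "\<dots> = cnj (LINT x|torus_measure. f x * cnj (g x))"
      by (rule Bochner_Integration.integral_cnj)
    finally show "Re (LINT x|torus_measure. f x * cnj (g x)) = Re (LINT x|torus_measure. g x * cnj (f x))"
      by simp
  qed
  show "inner (\<psi> + \<eta>) \<theta> = inner \<psi> \<theta> + inner \<eta> \<theta>"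
    unfolding inner_L2_def
    by transfer (simp add: L2_rel_def distrib_right integrable_mult_cnj Bochner_Integration.integral_add)
  show "inner (r *\<^sub>R \<psi>) \<eta> = r * inner \<psi> \<eta>"
    unfolding inner_L2_def scaleR_L2_def
    by transfer (simp add: mult.assoc)
  have *: "Re (LINT x|torus_measure. f x * cnj (f x)) = (LINT x|torus_measure. (cmod (f x))\<^sup>2)"
    if "L2_rel f f" for f :: "'a torus \<Rightarrow> complex"
  proof -
    have "(\<lambda>x. f x * cnj (f x)) = (\<lambda>x. complex_of_real ((cmod (f x))\<^sup>2))"
      by (intro ext) (rule complex_norm_square[symmetric])
    then show ?thesis by (simp only: integral_complex_of_real Re_complex_of_real)
  qed
  show "0 \<le> inner \<psi> \<psi>"
    unfolding inner_L2_def by transfer (simp add: *)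
  show "inner \<psi> \<psi> = 0 \<longleftrightarrow> \<psi> = 0"
    unfolding inner_L2_def
  proof transfer
    fix f :: "'a torus \<Rightarrow> complex" assume f: "L2_rel f f"
    then have i: "integrable torus_measure (\<lambda>x. (cmod (f x))\<^sup>2)"
      by (simp add: L2_rel_def square_integrable_def)
    have "square_integrable (\<lambda>_ :: 'a torus. 0)"
      by (rule square_integrable_bounded[where B=0]) auto
    then show "Re (LINT x|torus_measure. f x * cnj (f x)) = 0 \<longleftrightarrow> L2_rel f (\<lambda>_. 0)"
      unfolding *[OF f] using f
      by (subst integral_nonneg_eq_0_iff_AE[OF i]) (auto simp: L2_rel_def)
  qed
qed

end

lemma L2_rel_refl_iff: "L2_rel f f \<longleftrightarrow> square_integrable f"
  by (auto simp: L2_rel_def)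

lemma L2_rep: "square_integrable (rep_L2 \<psi>)" "abs_L2 (rep_L2 \<psi>) = \<psi>"
  using Quotient3_L2 unfolding Quotient3_def L2_rel_refl_iff[symmetric] by blast+

lemma abs_L2_diff:
  assumes "square_integrable f" "square_integrable g"
  shows "abs_L2 f - abs_L2 g = abs_L2 (\<lambda>x. f x - g x)"
  using assms
  by (simp add: minus_L2_def plus_L2.abs_eq uminus_L2.abs_eq L2_rel_refl_iff square_integrable_minus)

lemma square_integrable_diff:
  assumes "square_integrable f" "square_integrable g"
  shows "square_integrable (\<lambda>x. f x - g x)"
  using square_integrable_add[OF assms(1) square_integrable_minus[OF assms(2)]] by simp

lemma norm_abs_L2:
  assumes "square_integrable f"
  shows "(norm (abs_L2 f))\<^sup>2 = (LINT x|torus_measure. (cmod (f x))\<^sup>2)"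
proof -
  have "(\<lambda>x. f x * cnj (f x)) = (\<lambda>x. complex_of_real ((cmod (f x))\<^sup>2))"
    by (intro ext) (rule complex_norm_square[symmetric])
  then have "L2_inner (abs_L2 f) (abs_L2 f) = complex_of_real (LINT x|torus_measure. (cmod (f x))\<^sup>2)"
    using assms by (simp only: L2_inner.abs_eq L2_rel_refl_iff integral_complex_of_real)
  then show ?thesis
    unfolding power2_norm_eq_inner inner_L2_def by (simp only: Re_complex_of_real)
qed

lemma dist_abs_L2:
  assumes "square_integrable f" "square_integrable g"
  shows "(dist (abs_L2 f) (abs_L2 g))\<^sup>2 = (LINT x|torus_measure. (cmod (f x - g x))\<^sup>2)"
  unfolding dist_norm abs_L2_diff[OF assms] by (rule norm_abs_L2[OF square_integrable_diff[OF assms]])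

text \<open>Completeness and separability make Bochner integrals of functions with values in
  \<^typ>\<open>'d L2\<close> available.\<close>

instance L2 :: (finite) banach
proof
  fix X :: "nat \<Rightarrow> 'a L2" assume "Cauchy X"
  then have "\<forall>n. \<exists>N. \<forall>m\<ge>N. \<forall>k\<ge>N. dist (X m) (X k) < (1/2) ^ n"
    unfolding Cauchy_def by simp
  then obtain N where N: "\<And>n m k. m \<ge> N n \<Longrightarrow> k \<ge> N n \<Longrightarrow> dist (X m) (X k) < (1/2) ^ n"
    by metis
  define r where "r n = (\<Sum>i\<le>n. N i) + n" for n
  have r: "strict_mono r" by (auto simp: strict_mono_Suc_iff r_def)
  have rN: "N n \<le> r m" if "n \<le> m" for n m
  proof -
    have "N n \<le> (\<Sum>i\<le>m. N i)" using that by (intro member_le_sum) auto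
    then show ?thesis by (simp add: r_def)
  qed
  define f where "f n = rep_L2 (X (r n))" for n
  have sf: "square_integrable (f n)" and af: "abs_L2 (f n) = X (r n)" for n
    by (simp_all add: f_def L2_rep)
  note mf = square_integrable_measurable[OF sf]
  have ni: "(\<integral>\<^sup>+x. ennreal ((cmod (f m x - f k x))\<^sup>2) \<partial>torus_measure) \<le> ennreal (((1/2) ^ n)\<^sup>2)"
    and li: "(LINT x|torus_measure. (cmod (f m x - f k x))\<^sup>2) \<le> ((1/2) ^ n)\<^sup>2"
    if "n \<le> m" "n \<le> k" for n m k
  proof -
    have "(LINT x|torus_measure. (cmod (f m x - f k x))\<^sup>2) = (dist (X (r m)) (X (r k)))\<^sup>2"
      unfolding af[symmetric] by (rule dist_abs_L2[OF sf sf, symmetric])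
    also have "\<dots> \<le> ((1/2) ^ n)\<^sup>2"
      using N[OF rN[OF that(1)] rN[OF that(2)]] by (intro power_mono) auto
    finally show li: "(LINT x|torus_measure. (cmod (f m x - f k x))\<^sup>2) \<le> ((1/2) ^ n)\<^sup>2" .
    show "(\<integral>\<^sup>+x. ennreal ((cmod (f m x - f k x))\<^sup>2) \<partial>torus_measure) \<le> ennreal (((1/2) ^ n)\<^sup>2)"
      by (subst nn_integral_eq_integral[OF square_integrable_integrable[OF square_integrable_diff[OF sf sf]]])
        (use li in \<open>auto intro: ennreal_leI\<close>)
  qed
  define h where "h n x = cmod (f (Suc n) x - f n x)" for n x
  have mh: "h n \<in> borel_measurable torus_measure" for n
    unfolding h_def using mf by (auto intro!: borel_measurable_norm borel_measurable_diff)
  have ih: "(\<integral>\<^sup>+x. ennreal (h n x) \<partial>torus_measure) \<le> ennreal ((1/2) ^ n)" for n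
  proof -
    let ?b = "\<lambda>x. ((1/2) ^ n + 2 ^ n * (h n x)\<^sup>2) / 2"
    have i: "integrable torus_measure (\<lambda>x. (h n x)\<^sup>2)"
      unfolding h_def by (rule square_integrable_integrable[OF square_integrable_diff[OF sf sf]])
    have le: "h n x \<le> ?b x" for x
    proof -
      have p: "(1/2) ^ n * 2 ^ n = (1::real)" by (simp flip: power_mult_distrib)
      have "0 \<le> 2 ^ n * (h n x - (1/2) ^ n)\<^sup>2" by simp
      also have "\<dots> = 2 ^ n * (h n x)\<^sup>2 - 2 * ((1/2) ^ n * 2 ^ n) * h n x + ((1/2) ^ n * 2 ^ n) * (1/2) ^ n"
        by (simp add: power2_eq_square algebra_simps)
      finally show ?thesis unfolding p by simp
    qed
    have "(\<integral>\<^sup>+x. ennreal (h n x) \<partial>torus_measure) \<le> (\<integral>\<^sup>+x. ennreal (?b x) \<partial>torus_measure)"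
      using le by (intro nn_integral_mono ennreal_leI) auto
    also have "\<dots> = ennreal (LINT x|torus_measure. ?b x)"
      using i by (intro nn_integral_eq_integral) auto
    also have "(LINT x|torus_measure. ?b x)
        = ((1/2) ^ n + 2 ^ n * (LINT x|torus_measure. (h n x)\<^sup>2)) / 2"
      using i by (simp add: measure_def finite_measure_torus)
    also have "\<dots> \<le> ((1/2) ^ n + 2 ^ n * ((1/2) ^ n)\<^sup>2) / 2"
      using li[of n "Suc n" n] by (auto simp: h_def intro!: mult_left_mono)
    also have "\<dots> = (1/2) ^ n"
      by (simp add: power2_eq_square power_one_over)
    finally show ?thesis by (simp add: ennreal_leI)
  qed
  have "(\<integral>\<^sup>+x. (\<Sum>n. ennreal (h n x)) \<partial>torus_measure) = (\<Sum>n. \<integral>\<^sup>+x. ennreal (h n x) \<partial>torus_measure)"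
    using mh by (intro nn_integral_suminf) auto
  also have "\<dots> \<le> (\<Sum>n. ennreal ((1/2) ^ n))"
    by (intro suminf_le ih) auto
  also have "\<dots> = ennreal (\<Sum>n. (1/2) ^ n)"
    by (intro suminf_ennreal2) (auto intro: summable_geometric)
  also have "\<dots> < \<infinity>" by simp
  finally have "AE x in torus_measure. (\<Sum>n. ennreal (h n x)) \<noteq> \<infinity>"
    using mh by (intro nn_integral_PInf_AE) auto
  then have cv: "AE x in torus_measure. convergent (\<lambda>n. f n x)"
  proof eventually_elim
    case (elim x)
    have "summable (\<lambda>n. h n x)"
      using elim by (intro summable_suminf_not_top) (auto simp: h_def)
    then have "summable (\<lambda>n. f (Suc n) x - f n x)"
      unfolding h_def by (rule summable_norm_cancel)
    then have "convergent (\<lambda>n. \<Sum>i<n. f (Suc i) x - f i x)"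
      by (simp add: summable_iff_convergent)
    then have "convergent (\<lambda>n. f n x - f 0 x)"
      using sum_lessThan_telescope[of "\<lambda>n. f n x"] by simp
    then have "convergent (\<lambda>n. (f n x - f 0 x) + f 0 x)"
      by (intro convergent_add convergent_const)
    then show ?case by simp
  qed
  define g where "g x = lim (\<lambda>n. f n x)" for x
  have mg: "g \<in> borel_measurable torus_measure"
    unfolding g_def using mf by (intro borel_measurable_lim_metric) auto
  have lim: "AE x in torus_measure. (\<lambda>n. f n x) \<longlonglongrightarrow> g x"
    using cv by eventually_elim (simp add: g_def convergent_LIMSEQ_iff)
  have fatou: "(\<integral>\<^sup>+x. ennreal ((cmod (g x - f n x))\<^sup>2) \<partial>torus_measure) \<le> ennreal (((1/2) ^ n)\<^sup>2)" for n
  proof -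
    let ?u = "\<lambda>m x. ennreal ((cmod (f m x - f n x))\<^sup>2)"
    have "(\<integral>\<^sup>+x. ennreal ((cmod (g x - f n x))\<^sup>2) \<partial>torus_measure)
        = (\<integral>\<^sup>+x. liminf (\<lambda>m. ?u m x) \<partial>torus_measure)"
    proof (rule nn_integral_cong_AE, use lim in eventually_elim)
      case (elim x)
      have "(\<lambda>m. ?u m x) \<longlonglongrightarrow> ennreal ((cmod (g x - f n x))\<^sup>2)"
        by (intro tendsto_ennrealI tendsto_power tendsto_norm tendsto_diff elim tendsto_const)
      from lim_imp_Liminf[OF sequentially_bot this] show ?case by (rule sym)
    qed
    also have "\<dots> \<le> liminf (\<lambda>m. \<integral>\<^sup>+x. ?u m x \<partial>torus_measure)"
    proof (rule nn_integral_liminf)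
      show "?u m \<in> borel_measurable torus_measure" for m
        using mf[of m] mf[of n] by measurable
    qed
    also have "\<dots> \<le> limsup (\<lambda>m. \<integral>\<^sup>+x. ?u m x \<partial>torus_measure)"
      by (rule Liminf_le_Limsup) simp
    also have "\<dots> \<le> ennreal (((1/2) ^ n)\<^sup>2)"
      by (rule Limsup_bounded) (auto intro!: eventually_sequentiallyI[of n] ni)
    finally show ?thesis .
  qed
  have sg: "square_integrable (\<lambda>x. g x - f n x)" for n
    unfolding square_integrable_def
  proof (intro conjI integrableI_bounded)
    show "(\<integral>\<^sup>+x. ennreal (norm ((cmod (g x - f n x))\<^sup>2)) \<partial>torus_measure) < \<infinity>"
      using fatou[of n] by (simp add: le_less_trans)
  qed (use mg mf[of n] in measurable)
  have "square_integrable g"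
    using square_integrable_add[OF sg[of 0] sf[of 0]] by simp
  then have "dist (X (r n)) (abs_L2 g) \<le> (1/2) ^ n" for n
  proof -
    have "(dist (X (r n)) (abs_L2 g))\<^sup>2 = (LINT x|torus_measure. (cmod (g x - f n x))\<^sup>2)"
      unfolding af[symmetric] dist_commute[of _ "abs_L2 g"]
      by (rule dist_abs_L2[OF \<open>square_integrable g\<close> sf])
    also have "\<dots> \<le> ((1/2) ^ n)\<^sup>2"
      using fatou[of n]
      by (subst (asm) nn_integral_eq_integral[OF square_integrable_integrable[OF sg]]) (auto simp: ennreal_le_iff)
    finally show ?thesis by (rule power2_le_imp_le) simp
  qed
  moreover have "(\<lambda>n. (1/2) ^ n :: real) \<longlonglongrightarrow> 0" by (rule LIMSEQ_power_zero) simp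
  ultimately have "(\<lambda>n. dist (X (r n)) (abs_L2 g)) \<longlonglongrightarrow> 0"
    by (intro Lim_null_comparison[of "\<lambda>n. dist (X (r n)) (abs_L2 g)"] always_eventually allI) simp_all
  then have "(\<lambda>n. X (r n)) \<longlonglongrightarrow> abs_L2 g"
    by (subst tendsto_dist_iff)
  then have "X \<longlonglongrightarrow> abs_L2 g"
    by (intro Cauchy_converges_subseq[OF \<open>Cauchy X\<close> r]) (simp add: o_def)
  then show "convergent X" by (rule convergentI)
qed

lemma L2_scale_scale: "L2_scale a (L2_scale b \<psi>) = L2_scale (a * b) \<psi>"
  by transfer (auto simp: L2_rel_def mult.assoc intro!: square_integrable_const_mult)

lemma L2_inner_scale_left: "L2_inner (L2_scale c \<psi>) \<eta> = c * L2_inner \<psi> \<eta>"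
  by transfer (simp add: mult.assoc)

lemma L2_inner_scale_right: "L2_inner \<psi> (L2_scale c \<eta>) = cnj c * L2_inner \<psi> \<eta>"
  by transfer (simp add: mult.left_commute[of _ "cnj _"])

lemma norm_L2_scale: "norm (L2_scale c \<psi>) = cmod c * norm \<psi>"
proof -
  have "(norm (L2_scale c \<psi>))\<^sup>2 = Re (c * cnj c * L2_inner \<psi> \<psi>)"
    unfolding power2_norm_eq_inner inner_L2_def L2_inner_scale_left L2_inner_scale_right
    by (simp only: mult.assoc mult.left_commute)
  also have "\<dots> = (cmod c * norm \<psi>)\<^sup>2"
    unfolding complex_norm_square[symmetric] power_mult_distrib power2_norm_eq_inner inner_L2_def
    by (simp del: of_real_power)
  finally show ?thesis by (rule power2_eq_imp_eq) auto
qed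

lemma bounded_bilinear_L2_scale: "bounded_bilinear L2_scale"
proof
  fix a b :: complex and \<psi> \<eta> :: "'a L2" and r :: real
  show "L2_scale (a + b) \<psi> = L2_scale a \<psi> + L2_scale b \<psi>"
    by transfer (auto simp: L2_rel_def distrib_right
        intro!: square_integrable_add square_integrable_const_mult)
  show "L2_scale a (\<psi> + \<eta>) = L2_scale a \<psi> + L2_scale a \<eta>"
    by transfer (auto simp: L2_rel_def distrib_left
        intro!: square_integrable_add square_integrable_const_mult)
  show "L2_scale (r *\<^sub>R a) \<psi> = r *\<^sub>R L2_scale a \<psi>" "L2_scale a (r *\<^sub>R \<psi>) = r *\<^sub>R L2_scale a \<psi>"
    by (simp_all add: scaleR_L2_def L2_scale_scale scaleR_conv_of_real mult.commute)
  show "\<exists>K. \<forall>a \<psi>. norm (L2_scale a (\<psi> :: 'a L2)) \<le> norm a * norm \<psi> * K"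
    by (rule exI[of _ 1]) (simp add: norm_L2_scale)
qed

lemma tendsto_if_dist_power2:
  fixes u :: "nat \<Rightarrow> 'a::metric_space"
  assumes "(\<lambda>n. (dist (u n) l)\<^sup>2) \<longlonglongrightarrow> 0"
  shows "u \<longlonglongrightarrow> l"
proof -
  have "(\<lambda>n. sqrt ((dist (u n) l)\<^sup>2)) \<longlonglongrightarrow> sqrt 0"
    by (intro tendsto_real_sqrt assms)
  then have "(\<lambda>n. dist (u n) l) \<longlonglongrightarrow> 0" by simp
  then show ?thesis by (subst tendsto_dist_iff)
qed

instance L2 :: (finite) second_countable_topology
proof
  obtain B :: "'a torus set set" where B: "countable B" "topological_basis B"
    using ex_countable_basis by blast
  define G where "G = Inter ` {F. finite F \<and> F \<subseteq> B}"
  have "countable G"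
    unfolding G_def by (intro countable_image countable_Collect_finite_subset B)
  have "Int_stable G"
  proof (rule Int_stableI)
    fix P Q assume "P \<in> G" "Q \<in> G"
    then obtain F F' where "finite F" "F \<subseteq> B" "P = \<Inter>F" "finite F'" "F' \<subseteq> B" "Q = \<Inter>F'"
      by (auto simp: G_def)
    then show "P \<inter> Q \<in> G"
      unfolding G_def by (intro image_eqI[of _ _ "F \<union> F'"]) auto
  qed
  have "\<Inter>{} \<in> G" unfolding G_def by (intro imageI) simp
  then have "UNIV \<in> G" by (simp only: Inter_empty)
  have "open P" if "P \<in> G" for P
  proof -
    from that obtain F where "P = \<Inter>F" "F \<in> {F. finite F \<and> F \<subseteq> B}"
      unfolding G_def by (rule imageE)
    then have F: "finite F" "F \<subseteq> B" "P = \<Inter>F" by simp_all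
    have "\<forall>U\<in>F. open U" using F(2) topological_basis_open[OF B(2)] by blast
    with F show ?thesis by (simp only: open_Inter)
  qed
  have sG: "sigma_sets UNIV G = sets borel"
  proof
    show "sigma_sets UNIV G \<subseteq> sets borel"
    proof -
      have "G \<subseteq> sets borel" using \<open>\<And>P. P \<in> G \<Longrightarrow> open P\<close> by (intro subsetI borel_open)
      then show ?thesis using sets.sigma_sets_subset[of G borel] by (simp only: space_borel)
    qed
    have "\<Inter>{b} \<in> G" if "b \<in> B" for b unfolding G_def using that by (intro imageI) simp
    then have "B \<subseteq> G" by auto
    have "sets borel = sigma_sets UNIV B"
      unfolding borel_eq_countable_basis[OF B] by (rule sets_measure_of) simp
    also have "\<dots> \<subseteq> sigma_sets UNIV G"
      by (rule sigma_sets_mono') fact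
    finally show "sets borel \<subseteq> sigma_sets UNIV G" .
  qed
  define e where "e A = abs_L2 (indicator A :: 'a torus \<Rightarrow> complex)" for A
  have si: "square_integrable (indicator A :: 'a torus \<Rightarrow> complex)" if "A \<in> sets borel" for A
  proof (rule square_integrable_bounded[where B=1])
    show "(indicator A :: 'a torus \<Rightarrow> complex) \<in> borel_measurable torus_measure"
      by (rule borel_measurable_indicator) (simp add: that)
  qed (simp add: indicator_def)
  define t where "t = (\<lambda>(a, b, n). L2_scale (Complex (of_rat a) (of_rat b)) (e (from_nat_into G n)))"
  define gen where "gen xs = sum_list (map t xs)" for xs
  define C where "C = range gen"
  have "countable C" by (simp add: C_def)
  interpret L2_scale: bounded_bilinear "L2_scale :: complex \<Rightarrow> 'a L2 \<Rightarrow> _"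
    by (rule bounded_bilinear_L2_scale)
  have C0: "0 \<in> C" unfolding C_def by (rule range_eqI[of _ _ "[]"]) (simp add: gen_def)
  have Cadd: "x + y \<in> C" if "x \<in> C" "y \<in> C" for x y
  proof -
    obtain xs ys where "x = gen xs" "y = gen ys" using \<open>x \<in> C\<close> \<open>y \<in> C\<close> by (auto simp: C_def)
    then have "x + y = gen (xs @ ys)" by (simp add: gen_def)
    then show ?thesis by (simp add: C_def)
  qed
  have Cscale: "L2_scale (Complex (of_rat p) (of_rat q)) x \<in> C" if "x \<in> C" for x p q
  proof -
    obtain xs where "x = gen xs" using \<open>x \<in> C\<close> by (auto simp: C_def)
    moreover have "L2_scale (Complex (of_rat p) (of_rat q)) (gen xs) \<in> C"
    proof (induction xs)
      case Nil
      then show ?case using C0 by (simp add: gen_def L2_scale.zero_right)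
    next
      case (Cons z xs)
      obtain a b n where z: "z = (a, b, n)" by (metis prod_cases3)
      have "L2_scale (Complex (of_rat p) (of_rat q)) (t z) = t (p * a - q * b, p * b + q * a, n)"
        by (simp add: t_def z L2_scale_scale complex_mult of_rat_diff of_rat_mult of_rat_add)
      then have "L2_scale (Complex (of_rat p) (of_rat q)) (t z) \<in> C"
        unfolding C_def by (intro range_eqI[of _ _ "[_]"]) (simp add: gen_def)
      then show ?case using Cons by (simp add: gen_def L2_scale.add_right Cadd)
    qed
    ultimately show ?thesis by simp
  qed
  have Kadd: "x + y \<in> closure C" if "x \<in> closure C" "y \<in> closure C" for x y
  proof -
    from that obtain u v where "\<And>n. u n \<in> C" "u \<longlonglongrightarrow> x" "\<And>n. v n \<in> C" "v \<longlonglongrightarrow> y"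
      unfolding closure_sequential by blast
    then have "\<And>n. u n + v n \<in> C" "(\<lambda>n. u n + v n) \<longlonglongrightarrow> x + y"
      by (auto intro: Cadd tendsto_add)
    then show ?thesis unfolding closure_sequential by (intro exI[of _ "\<lambda>n. u n + v n"]) auto
  qed
  have Kscale: "L2_scale c x \<in> closure C" if "x \<in> closure C" for c x
  proof -
    from that obtain u where u: "\<And>n. u n \<in> C" "u \<longlonglongrightarrow> x"
      unfolding closure_sequential by blast
    have ex: "\<exists>q :: nat \<Rightarrow> rat. (\<lambda>n. of_rat (q n)) \<longlonglongrightarrow> y" for y :: real
    proof -
      have "\<exists>q. y < of_rat q \<and> of_rat q < y + inverse (real (Suc n))" for n
        by (rule of_rat_dense) simp
      then obtain q where q: "\<And>n. y < of_rat (q n)" "\<And>n. of_rat (q n) < y + inverse (real (Suc n))"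
        by metis
      have "(\<lambda>n. y + inverse (real (Suc n))) \<longlonglongrightarrow> y"
        using LIMSEQ_inverse_real_of_nat_add by simp
      then have "(\<lambda>n. of_rat (q n)) \<longlonglongrightarrow> y"
        by (rule tendsto_sandwich[OF _ _ tendsto_const, rotated 2])
          (use q in \<open>auto intro!: always_eventually less_imp_le\<close>)
      then show ?thesis by blast
    qed
    obtain p q where pq: "(\<lambda>n. of_rat (p n)) \<longlonglongrightarrow> Re c" "(\<lambda>n. of_rat (q n)) \<longlonglongrightarrow> Im c"
      using ex by metis
    have "(\<lambda>n. Complex (of_rat (p n)) (of_rat (q n))) \<longlonglongrightarrow> Complex (Re c) (Im c)"
      by (intro tendsto_Complex pq)
    then have "(\<lambda>n. L2_scale (Complex (of_rat (p n)) (of_rat (q n))) (u n)) \<longlonglongrightarrow> L2_scale c x"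
      using u(2) by (intro L2_scale.tendsto) auto
    with u(1) show ?thesis
      unfolding closure_sequential
      by (intro exI[of _ "\<lambda>n. L2_scale (Complex (of_rat (p n)) (of_rat (q n))) (u n)"]) (auto intro: Cscale)
  qed
  have Kdiff: "x - y \<in> closure C" if "x \<in> closure C" "y \<in> closure C" for x y
  proof -
    have "- y = L2_scale (-1) y"
      using scaleR_L2_def[of "-1" y] by simp
    then have "x - y = x + L2_scale (-1) y" by (metis diff_conv_add_uminus)
    then show ?thesis using Kadd[OF that(1) Kscale[OF that(2)]] by metis
  qed
  have eG: "e A \<in> closure C" if "A \<in> G" for A
  proof -
    obtain n where "A = from_nat_into G n"
      using from_nat_into_surj[OF \<open>countable G\<close> \<open>A \<in> G\<close>] by metis
    moreover have "Complex 1 0 = of_real 1" by (simp add: complex_eq_iff)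
    then have "L2_scale (Complex 1 0) \<psi> = \<psi>" for \<psi> :: "'a L2"
      by (metis scaleR_L2_def scaleR_one)
    ultimately have "gen [(1, 0, n)] = e A" by (simp add: gen_def t_def)
    then have "e A \<in> C" unfolding C_def by (metis rangeI)
    then show ?thesis using closure_subset by blast
  qed
  have e_add: "e (A \<union> A') = e A + e A'" if "A \<in> sets borel" "A' \<in> sets borel" "A \<inter> A' = {}" for A A'
  proof -
    have "(indicator (A \<union> A') :: 'a torus \<Rightarrow> complex) = (\<lambda>x. indicator A x + indicator A' x)"
      using that(3) by (auto simp: fun_eq_iff indicator_def)
    then show ?thesis
      unfolding e_def using that by (simp add: plus_L2.abs_eq L2_rel_refl_iff si)
  qed
  have e_norm: "(norm (e A))\<^sup>2 = measure torus_measure A" if "A \<in> sets borel" for A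
  proof -
    have "(\<lambda>x. (cmod (indicator A x))\<^sup>2) = (indicator A :: 'a torus \<Rightarrow> real)"
      by (auto simp: indicator_def)
    then show ?thesis using that by (simp add: e_def norm_abs_L2 si)
  qed
  have e_borel: "e A \<in> closure C" if "A \<in> sets borel" for A
  proof -
    have "Int_stable G" "G \<subseteq> Pow UNIV" "A \<in> sigma_sets UNIV G"
      using \<open>Int_stable G\<close> that sG by auto
    then show ?thesis
    proof (induction rule: sigma_sets_induct_disjoint)
      case (basic A) then show ?case by (rule eG)
    next
      case empty
      have "(norm (e {}))\<^sup>2 = 0" by (simp add: e_norm)
      then show ?case using C0 closure_subset by auto
    next
      case (compl A)
      have "e (UNIV - A \<union> A) = e (UNIV - A) + e A"
        using compl(1) by (intro e_add) (auto simp: sG)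
      then have "e (UNIV - A) = e UNIV - e A" by simp
      then show ?case using Kdiff[OF eG[OF \<open>UNIV \<in> G\<close>] compl(2)] by simp
    next
      case (union A)
      then have A: "\<And>i. A i \<in> sets borel" by (auto simp: sG)
      let ?U = "\<lambda>n. \<Union>i<n. A i"
      have mU: "?U n \<in> sets borel" for n using A by auto
      have mA: "(\<Union>i. A i) \<in> sets borel" using A by auto
      have eU: "e (?U n) \<in> closure C" for n
      proof (induction n)
        case 0
        have "(norm (e {}))\<^sup>2 = 0" by (simp add: e_norm)
        then show ?case using C0 closure_subset by auto
      next
        case (Suc n)
        have "?U (Suc n) = ?U n \<union> A n" by (auto simp: lessThan_Suc)
        moreover have "?U n \<inter> A n = {}"
        proof -
          have "A i \<inter> A n = {}" if "i < n" for i
            using disjoint_family_onD[OF union(1), of i n] that by simp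
          then show ?thesis by blast
        qed
        ultimately have "e (?U (Suc n)) = e (?U n) + e (A n)"
          using e_add[OF mU A] by simp
        then show ?case using Suc union(3) by (simp add: Kadd)
      qed
      have d: "(dist (e (?U n)) (e (\<Union>i. A i)))\<^sup>2 = measure torus_measure (\<Union>i. A i) - measure torus_measure (?U n)" for n
      proof -
        have "e (?U n \<union> ((\<Union>i. A i) - ?U n)) = e (?U n) + e ((\<Union>i. A i) - ?U n)"
          using mU mA by (intro e_add) auto
        moreover have "?U n \<union> ((\<Union>i. A i) - ?U n) = (\<Union>i. A i)" by auto
        ultimately have "dist (e (?U n)) (e (\<Union>i. A i)) = norm (e ((\<Union>i. A i) - ?U n))"
          by (simp add: dist_norm)
        then have "(dist (e (?U n)) (e (\<Union>i. A i)))\<^sup>2 = measure torus_measure ((\<Union>i. A i) - ?U n)"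
          using e_norm[OF sets.Diff[OF mA mU]] by simp
        also have "\<dots> = measure torus_measure (\<Union>i. A i) - measure torus_measure (?U n)"
          using mU mA by (intro torus_measure.finite_measure_Diff) auto
        finally show ?thesis .
      qed
      have "(\<lambda>n. measure torus_measure (?U n)) \<longlonglongrightarrow> measure torus_measure (\<Union>n. ?U n)"
        using mU by (intro torus_measure.finite_Lim_measure_incseq)
          (auto simp: incseq_def intro: less_le_trans)
      moreover have "(\<Union>n. ?U n) = (\<Union>i. A i)" by auto
      ultimately have "(\<lambda>n. (dist (e (?U n)) (e (\<Union>i. A i)))\<^sup>2) \<longlonglongrightarrow> 0"
        unfolding d by (auto intro!: tendsto_eq_intros)
      then have "(\<lambda>n. e (?U n)) \<longlonglongrightarrow> e (\<Union>i. A i)"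
        by (rule tendsto_if_dist_power2)
      then show ?case
        by (rule Lim_in_closed_set[OF closed_closure always_eventually[OF allI[OF eU]] sequentially_bot])
    qed
  qed
  have simple: "square_integrable (\<lambda>x. \<Sum>y\<in>S. c y * indicator (D y) x) \<and>
      abs_L2 (\<lambda>x. \<Sum>y\<in>S. c y * indicator (D y) x) \<in> closure C"
    if "finite S" "\<And>y. y \<in> S \<Longrightarrow> D y \<in> sets borel"
    for S :: "complex set" and c and D :: "complex \<Rightarrow> 'a torus set"
    using that
  proof (induction S)
    case empty
    have "square_integrable (\<lambda>_ :: 'a torus. 0)" by (rule square_integrable_bounded[where B=0]) auto
    then show ?case using C0 closure_subset by (auto simp: zero_L2.abs_eq[symmetric])
  next
    case (insert y S)
    let ?s = "\<lambda>x. \<Sum>y\<in>S. c y * indicator (D y) x"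
    have IH: "square_integrable ?s" "abs_L2 ?s \<in> closure C" using insert by auto
    have "square_integrable (\<lambda>x. c y * indicator (D y) x)"
      using insert by (intro square_integrable_const_mult si) auto
    moreover have "L2_scale (c y) (e (D y)) = abs_L2 (\<lambda>x. c y * indicator (D y) x)"
      unfolding e_def using insert by (intro L2_scale.abs_eq) (auto simp: L2_rel_refl_iff si)
    then have "abs_L2 (\<lambda>x. c y * indicator (D y) x) \<in> closure C"
      using Kscale[OF e_borel[of "D y"], of "c y"] insert by simp
    ultimately have "square_integrable (\<lambda>x. c y * indicator (D y) x + ?s x)"
      "abs_L2 (\<lambda>x. c y * indicator (D y) x) + abs_L2 ?s \<in> closure C"
      "abs_L2 (\<lambda>x. c y * indicator (D y) x) + abs_L2 ?s = abs_L2 (\<lambda>x. c y * indicator (D y) x + ?s x)"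
      using IH by (auto intro: square_integrable_add Kadd plus_L2.abs_eq simp: L2_rel_refl_iff)
    then show ?case
      by (simp only: sum.insert[OF insert(1,2)] simp_thms)
  qed
  have dense: "\<psi> \<in> closure C" for \<psi>
  proof -
    define f where "f = rep_L2 \<psi>"
    have f: "square_integrable f" "abs_L2 f = \<psi>" by (simp_all add: f_def L2_rep)
    obtain F where F: "\<And>i. simple_function torus_measure (F i)"
      "\<And>x. (\<lambda>i. F i x) \<longlonglongrightarrow> f x" "\<And>i x. norm (F i x) \<le> 2 * norm (f x)"
      using borel_measurable_implies_sequence_metric[OF square_integrable_measurable[OF f(1)], of 0]
      by (auto simp: dist_norm)
    have FK: "square_integrable (F i) \<and> abs_L2 (F i) \<in> closure C" for i
    proof -
      have "F i x = (\<Sum>y\<in>range (F i). y * indicator (F i -` {y}) x)" for x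
      proof -
        have "F i x = (\<Sum>y\<in>F i ` space torus_measure.
            indicator (F i -` {y} \<inter> space torus_measure) x *\<^sub>R y)"
          by (rule simple_function_indicator_representation_banach[OF F(1)]) simp
        also have "\<dots> = (\<Sum>y\<in>range (F i). y * indicator (F i -` {y}) x)"
          by (intro sum.cong) (auto simp: indicator_def)
        finally show ?thesis .
      qed
      then have eq: "F i = (\<lambda>x. \<Sum>y\<in>range (F i). y * indicator (F i -` {y}) x)" by (intro ext)
      have "finite (range (F i))" "\<And>y. F i -` {y} \<in> sets borel"
        using simple_functionD[OF F(1)[of i]] by auto
      from simple[of "range (F i)" "\<lambda>y. F i -` {y}" "\<lambda>y. y", OF this] show ?thesis unfolding eq[symmetric] .
    qed
    have "(\<lambda>i. LINT x|torus_measure. (cmod (F i x - f x))\<^sup>2) \<longlonglongrightarrow> (LINT (x :: 'a torus)|torus_measure. (0::real))"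
    proof (rule integral_dominated_convergence[where w="\<lambda>x. 9 * (cmod (f x))\<^sup>2"])
      show "AE x in torus_measure. (\<lambda>i. (cmod (F i x - f x))\<^sup>2) \<longlonglongrightarrow> 0"
      proof (rule AE_I2)
        fix x
        have "(\<lambda>i. (cmod (F i x - f x))\<^sup>2) \<longlonglongrightarrow> (cmod (f x - f x))\<^sup>2"
          by (intro tendsto_power tendsto_norm tendsto_diff F(2) tendsto_const)
        then show "(\<lambda>i. (cmod (F i x - f x))\<^sup>2) \<longlonglongrightarrow> 0" by simp
      qed
      show "AE x in torus_measure. norm ((cmod (F i x - f x))\<^sup>2) \<le> 9 * (cmod (f x))\<^sup>2" for i
      proof (rule AE_I2)
        fix x
        have "cmod (F i x - f x) \<le> 3 * cmod (f x)"
          using norm_triangle_ineq4[of "F i x" "f x"] F(3)[of i x] by simp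
        then have "(cmod (F i x - f x))\<^sup>2 \<le> (3 * cmod (f x))\<^sup>2" by (intro power_mono) auto
        then show "norm ((cmod (F i x - f x))\<^sup>2) \<le> 9 * (cmod (f x))\<^sup>2"
          by (simp add: power_mult_distrib)
      qed
    qed (use square_integrable_integrable[OF square_integrable_diff] FK f in
          \<open>auto intro: square_integrable_integrable\<close>)
    moreover have "(LINT x|torus_measure. (cmod (F i x - f x))\<^sup>2) = (dist (abs_L2 (F i)) \<psi>)\<^sup>2" for i
      unfolding f(2)[symmetric] using FK f(1) by (intro dist_abs_L2[symmetric]) auto
    ultimately have "(\<lambda>i. (dist (abs_L2 (F i)) \<psi>)\<^sup>2) \<longlonglongrightarrow> 0" by simp
    then have "(\<lambda>i. abs_L2 (F i)) \<longlonglongrightarrow> \<psi>"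
      by (rule tendsto_if_dist_power2)
    then show ?thesis
      using FK by (intro Lim_in_closed_set[OF closed_closure _ sequentially_bot]) simp_all
  qed
  let ?B = "(\<lambda>(c, n). ball c (inverse (real (Suc n)))) ` (C \<times> UNIV)"
  have "topological_basis ?B"
  proof (rule topological_basisI)
    fix U assume "U \<in> ?B" then show "open U" by auto
  next
    fix U :: "'a L2 set" and x assume "open U" "x \<in> U"
    then obtain \<epsilon> where \<epsilon>: "\<epsilon> > 0" "ball x \<epsilon> \<subseteq> U" by (meson open_contains_ball)
    obtain n where n: "inverse (real (Suc n)) < \<epsilon> / 2"
      using reals_Archimedean[of "\<epsilon> / 2"] \<epsilon> by auto
    obtain c where c: "c \<in> C" "dist c x < inverse (real (Suc n))"
      using dense[of x] unfolding closure_approachable by (metis inverse_positive_iff_positive of_nat_0_less_iff zero_less_Suc)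
    have "ball c (inverse (real (Suc n))) \<subseteq> U"
    proof
      fix y assume "y \<in> ball c (inverse (real (Suc n)))"
      then have "dist x y < \<epsilon>"
        using c(2) n dist_triangle[of x y c] by (simp add: dist_commute)
      then show "y \<in> U" using \<epsilon> by auto
    qed
    with c show "\<exists>W\<in>?B. x \<in> W \<and> W \<subseteq> U"
      by (intro bexI[of _ "ball c (inverse (real (Suc n)))"]) auto
  qed
  moreover have "countable ?B" using \<open>countable C\<close> by auto
  ultimately show "\<exists>B::'a L2 set set. countable B \<and> open = generate_topology B"
    by (metis topological_basis_imp_subbasis)
qed

section \<open>The free Schroedinger group\<close>

lift_definition fourier_mode :: "int ^ 'd \<Rightarrow> ('d::finite) L2" is character
proof -
  fix k :: "int ^ 'd"
  have "character k \<in> borel_measurable borel"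
    by (intro borel_measurable_continuous_onI continuous_on_character)
  then have "character k \<in> borel_measurable torus_measure"
    by (simp cong: measurable_cong_sets)
  then show "L2_rel (character k) (character k)"
    unfolding L2_rel_refl_iff by (rule square_integrable_bounded[where B=1]) simp
qed

definition laplacian_eigenvalue :: "int ^ 'd \<Rightarrow> real"
  where "laplacian_eigenvalue k = - 4 * pi\<^sup>2 * (\<Sum>i\<in>UNIV. (of_int (k $ i))\<^sup>2)"

text \<open>The operator $e^{it\Delta/2}$ of the spectral calculus: the Fourier modes form an orthonormal
  basis of eigenfunctions of $\Delta$, with \<open>\<Delta> e\<^sub>k = laplacian_eigenvalue k \<cdot> e\<^sub>k\<close>. The sum
  converges unconditionally in the norm of \<^typ>\<open>'d L2\<close>.\<close>

definition schroedinger_group :: "real \<Rightarrow> ('d::finite) L2 \<Rightarrow> 'd L2"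
  where "schroedinger_group t \<psi> =
    (\<Sum>\<^sub>\<infinity>k. L2_scale (exp (\<i> * t * laplacian_eigenvalue k / 2) * L2_inner \<psi> (fourier_mode k)) (fourier_mode k))"

definition L2_adjoint :: "(('d::finite) L2 \<Rightarrow> 'd L2) \<Rightarrow> 'd L2 \<Rightarrow> 'd L2"
  where "L2_adjoint T = (SOME S. \<forall>\<psi> \<eta>. L2_inner (T \<psi>) \<eta> = L2_inner \<psi> (S \<eta>))"

section \<open>Borel probability measures\<close>

definition borel_probabilities :: "'a::topological_space set \<Rightarrow> 'a measure set"
  where "borel_probabilities Z = {\<mu>. prob_space \<mu> \<and> sets \<mu> = sets (restrict_space borel Z)}"

definition measure_support :: "'a::topological_space measure \<Rightarrow> 'a set"
  where "measure_support \<mu> =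
    {z \<in> space \<mu>. \<forall>U. open U \<longrightarrow> z \<in> U \<longrightarrow> 0 < emeasure \<mu> (U \<inter> space \<mu>)}"

section \<open>The kinetic Schroedinger--Lohe equation without Hartree term\<close>

type_synonym 'd phase = "'d L2 \<times> ('d torus \<Rightarrow>\<^sub>C real)"

definition phase_space :: "('d::finite) phase set"
  where "phase_space = sphere 0 1 \<times> UNIV"

definition state_marginal :: "('d::finite) phase measure \<Rightarrow> 'd L2 measure"
  where "state_marginal f = distr f (restrict_space borel (sphere 0 1)) fst"

definition state_diameter :: "('d::finite) phase measure \<Rightarrow> real"
  where "state_diameter f = diameter (measure_support (state_marginal f))"

definition free_field :: "real \<Rightarrow> real \<Rightarrow> ('d::finite) L2 \<Rightarrow> ('d torus \<Rightarrow>\<^sub>C real) \<Rightarrow> 'd L2"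
  where "free_field hbar t \<phi> V =
    L2_scale (1 / (\<i> * hbar))
      (L2_adjoint (schroedinger_group (hbar * t)) (L2_potential V (schroedinger_group (hbar * t) \<phi>)))"

definition lohe_coupling :: "('d::finite) phase measure \<Rightarrow> 'd L2 \<Rightarrow> 'd L2"
  where "lohe_coupling f \<phi> = (LINT \<theta>|state_marginal f. \<theta> - L2_scale (L2_inner \<phi> \<theta>) \<phi>)"

definition characteristic_flow ::
    "real \<Rightarrow> real \<Rightarrow> (real \<Rightarrow> ('d::finite) phase measure) \<Rightarrow> (real \<Rightarrow> 'd phase \<Rightarrow> 'd L2) \<Rightarrow> bool"
  where "characteristic_flow hbar \<kappa> f \<Phi> \<longleftrightarrow>
    (\<forall>(\<phi>\<^sub>0, V) \<in> phase_space. \<Phi> 0 (\<phi>\<^sub>0, V) = \<phi>\<^sub>0 \<and>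
      (\<forall>t\<ge>0. ((\<lambda>s. \<Phi> s (\<phi>\<^sub>0, V)) has_vector_derivative
        free_field hbar t (\<Phi> t (\<phi>\<^sub>0, V)) V + (\<kappa> / 2) *\<^sub>R lohe_coupling (f t) (\<Phi> t (\<phi>\<^sub>0, V)))
        (at t within {0..})))"

text \<open>Lagrangian solutions on the time interval $[0,\infty)$: the equation is nonlinear, as the
  measure transported by the flow also enters the vector field of the flow.\<close>

definition schroedinger_lohe_solution ::
    "real \<Rightarrow> real \<Rightarrow> ('d::finite) phase measure \<Rightarrow> (real \<Rightarrow> 'd phase measure) \<Rightarrow> bool"
  where "schroedinger_lohe_solution hbar \<kappa> f\<^sub>0 f \<longleftrightarrow>
    f\<^sub>0 \<in> borel_probabilities phase_space \<and>
    (\<exists>\<Phi>. characteristic_flow hbar \<kappa> f \<Phi> \<and>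
      (\<forall>t\<ge>0. (\<lambda>(\<phi>\<^sub>0, V). (\<Phi> t (\<phi>\<^sub>0, V), V))
            \<in> restrict_space borel phase_space \<rightarrow>\<^sub>M restrict_space borel phase_space \<and>
          f t = distr f\<^sub>0 (restrict_space borel phase_space) (\<lambda>(\<phi>\<^sub>0, V). (\<Phi> t (\<phi>\<^sub>0, V), V))))"

text \<open>The suprema also range over all coupling strengths of the family. They are extended reals,
  so that finiteness is a genuine hypothesis.\<close>

definition potential_bound :: "(real \<Rightarrow> ('d::finite) phase measure) \<Rightarrow> ereal"
  where "potential_bound f\<^sub>0 =
    (SUP \<kappa>\<in>{0<..}. SUP (\<phi>, V)\<in>measure_support (f\<^sub>0 \<kappa>). ereal (norm V))"

definition potential_spread :: "real \<Rightarrow> (real \<Rightarrow> ('d::finite) phase measure) \<Rightarrow> ereal"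
  where "potential_spread hbar f\<^sub>0 = ereal (1 / hbar) *
    (SUP \<kappa>\<in>{0<..}. SUP ((\<phi>\<^sub>1, V\<^sub>1), (\<phi>\<^sub>2, V\<^sub>2))\<in>measure_support (f\<^sub>0 \<kappa>) \<times> measure_support (f\<^sub>0 \<kappa>).
      ereal (norm (V\<^sub>1 - V\<^sub>2)))"

definition xi2 :: "real \<Rightarrow> real"
  where "xi2 \<eta> = Max {z. z\<^sup>2 - 1 / 4 * z + \<eta> = 0}"

end

theory Submission
  imports Defs
begin

text \<open>Let \<open>d = \<parallel>\<phi>\<^sub>1 - \<phi>\<^sub>2\<parallel>\<close> for two characteristics that start in the support of the initial measure.
  The group \<open>U\<close> is a contraction, so the free fields contribute at most \<open>\<alpha> d\<close> to \<open>(d\<^sup>2)' / 2\<close>; this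
  uses only the orthonormality of the Fourier modes, not their completeness. If all characteristics
  stay within distance \<open>R\<close> of each other, the coupling contributes at most
  \<open>\<kappa>/2 (3/4 R\<^sup>2 - 1) d\<^sup>2\<close>. With \<open>R = 1/2\<close> this gives
  \<open>(d\<^sup>2)' \<le> -\<kappa>/4 (d\<^sup>2 - 8 (\<alpha>/\<kappa>)\<^sup>2)\<close>. For \<open>\<kappa> > 64 \<alpha>\<close> the initial diameter is below
  \<open>\<xi>\<^sub>2 \<le> 1/4\<close> and the inequality traps all distances below \<open>1/4\<close>, so the limit superior of the
  diameter is at most \<open>\<surd>8 \<alpha>/\<kappa>\<close>. Since the space of potentials is separable, the support carries
  the whole initial measure, and the support of the transported marginal lies in the closure of the
  transported support.\<close>

section \<open>The complex inner product\<close>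

text \<open>Together with \<open>inner_L2_def\<close> this expresses both parts of
  \<open>L2_inner\<close> through the real inner product, so that facts about real inner product
  spaces carry over to the complex one.\<close>

lemma inner_L2_scale_i: "inner \<psi> (L2_scale \<i> \<eta>) = Im (L2_inner \<psi> \<eta>)"
  by (simp add: inner_L2_def L2_inner_scale_right)

lemma L2_inner_commute: "L2_inner \<eta> \<psi> = cnj (L2_inner \<psi> \<eta>)"
proof (rule complex_eqI)
  show "Re (L2_inner \<eta> \<psi>) = Re (cnj (L2_inner \<psi> \<eta>))"
    using inner_commute[of \<eta> \<psi>] by (simp add: inner_L2_def)
  show "Im (L2_inner \<eta> \<psi>) = Im (cnj (L2_inner \<psi> \<eta>))"
    unfolding inner_L2_scale_i[symmetric] inner_commute[of \<eta>]
    by (simp add: inner_L2_def L2_inner_scale_left)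
qed

lemma L2_inner_self: "L2_inner \<psi> \<psi> = complex_of_real ((norm \<psi>)\<^sup>2)"
proof (rule complex_eqI)
  show "Im (L2_inner \<psi> \<psi>) = Im (complex_of_real ((norm \<psi>)\<^sup>2))"
    using arg_cong[OF L2_inner_commute[of \<psi> \<psi>], of Im] by simp
qed (simp only: power2_norm_eq_inner inner_L2_def Re_complex_of_real)

text \<open>Rotating \<open>\<psi>\<close> by the phase that makes the inner product real and
  nonnegative reduces the claim to the real Cauchy-Schwarz inequality.\<close>

lemma norm_L2_inner_le: "cmod (L2_inner \<psi> \<eta>) \<le> norm \<psi> * norm \<eta>"
proof (cases "L2_inner \<psi> \<eta> = 0")
  case False
  define z where "z = L2_inner \<psi> \<eta>"
  have "cnj z / cmod z * z = cmod z"
    using False complex_norm_square[of z]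
    by (simp add: z_def field_simps power2_eq_square del: of_real_power)
  then have "cmod z = inner (L2_scale (cnj z / cmod z) \<psi>) \<eta>"
    by (simp add: inner_L2_def L2_inner_scale_left z_def[symmetric])
  also have "\<dots> \<le> norm (L2_scale (cnj z / cmod z) \<psi>) * norm \<eta>"
    by (rule norm_cauchy_schwarz)
  also have "\<dots> = norm \<psi> * norm \<eta>"
    using False by (simp add: norm_L2_scale norm_divide z_def)
  finally show ?thesis by (simp add: z_def)
qed simp

interpretation L2_scale: bounded_bilinear "L2_scale :: complex \<Rightarrow> ('d::finite) L2 \<Rightarrow> _"
  by (rule bounded_bilinear_L2_scale)

text \<open>Bilinearity is over the reals, as \<open>L2_inner\<close> is conjugate linear in its
  second argument. It supplies difference rules, continuity and the passage through infinite
  sums.\<close>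

interpretation L2_inner: bounded_bilinear "L2_inner :: ('d::finite) L2 \<Rightarrow> _"
proof
  fix \<psi> \<psi>' \<eta> \<eta>' :: "'d L2" and r :: real
  show "L2_inner (\<psi> + \<psi>') \<eta> = L2_inner \<psi> \<eta> + L2_inner \<psi>' \<eta>"
    by (rule complex_eqI)
      (simp_all flip: inner_L2_scale_i inner_L2_def add: inner_add_left)
  show "L2_inner \<psi> (\<eta> + \<eta>') = L2_inner \<psi> \<eta> + L2_inner \<psi> \<eta>'"
    by (rule complex_eqI)
      (simp_all flip: inner_L2_scale_i inner_L2_def add: inner_add_right L2_scale.add_right)
  show "L2_inner (r *\<^sub>R \<psi>) \<eta> = r *\<^sub>R L2_inner \<psi> \<eta>" "L2_inner \<psi> (r *\<^sub>R \<eta>) = r *\<^sub>R L2_inner \<psi> \<eta>"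
    by (simp_all add: scaleR_L2_def L2_inner_scale_left L2_inner_scale_right scaleR_conv_of_real)
  show "\<exists>K. \<forall>\<psi> \<eta>. norm (L2_inner \<psi> (\<eta> :: 'd L2)) \<le> norm \<psi> * norm \<eta> * K"
    by (rule exI[of _ 1]) (simp add: norm_L2_inner_le)
qed

section \<open>Orthonormality of the Fourier modes\<close>

text \<open>\<open>lborel\<close> is the image of a product of one-dimensional Lebesgue measures,
  over which a product of functions of single coordinates factorises by Fubini.\<close>

lemma integral_lborel_prod:
  fixes f :: "'a::euclidean_space \<Rightarrow> real \<Rightarrow> 'b::{real_normed_field, banach, second_countable_topology}"
  assumes "\<And>b. b \<in> Basis \<Longrightarrow> integrable lborel (f b)"
  shows "(\<integral>x. (\<Prod>b\<in>Basis. f b (x \<bullet> b)) \<partial>lborel) = (\<Prod>b\<in>Basis. integral\<^sup>L lborel (f b))"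
proof -
  interpret product_sigma_finite "\<lambda>_ :: 'a. lborel :: real measure" ..
  let ?P = "\<Pi>\<^sub>M b\<in>(Basis :: 'a set). (lborel :: real measure)"
  have [measurable]: "f b \<in> borel_measurable borel" if "b \<in> Basis" for b
    using borel_measurable_integrable[OF assms[OF that]] by simp
  have "(\<integral>x. (\<Prod>b\<in>Basis. f b (x \<bullet> b)) \<partial>lborel)
      = (\<integral>y. (\<Prod>b\<in>Basis. f b ((\<Sum>c\<in>Basis. y c *\<^sub>R c) \<bullet> b)) \<partial>?P)"
    by (subst lborel_eq, subst integral_distr) simp_all
  also have "\<dots> = (\<integral>y. (\<Prod>b\<in>Basis. f b (y b)) \<partial>?P)"
    by (intro Bochner_Integration.integral_cong prod.cong refl) simp
  also have "\<dots> = (\<Prod>b\<in>Basis. integral\<^sup>L lborel (f b))"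
    by (rule product_integral_prod) (use assms in auto)
  finally show ?thesis .
qed

lemma integral_lborel_prod_cart:
  fixes g :: "'n::finite \<Rightarrow> real \<Rightarrow> 'b::{real_normed_field, banach, second_countable_topology}"
  assumes "\<And>i. integrable lborel (g i)"
  shows "(\<integral>x. (\<Prod>i\<in>UNIV. g i (x $ i)) \<partial>(lborel :: (real ^ 'n) measure)) = (\<Prod>i\<in>UNIV. integral\<^sup>L lborel (g i))"
proof -
  have B: "(Basis :: (real ^ 'n) set) = range (\<lambda>i. axis i 1)"
    by (auto simp: Basis_vec_def)
  have inj: "inj (\<lambda>i :: 'n. axis i (1 :: real))"
    by (auto simp: inj_on_def axis_eq_axis)
  define G where "G b = g (inv (\<lambda>i. axis i 1) b)" for b :: "real ^ 'n"
  have G: "G (axis i 1) = g i" for i unfolding G_def by (simp add: inv_f_f[OF inj])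
  have "(\<integral>x. (\<Prod>b\<in>Basis. G b (x \<bullet> b)) \<partial>(lborel :: (real ^ 'n) measure)) = (\<Prod>b\<in>Basis. integral\<^sup>L lborel (G b))"
    by (rule integral_lborel_prod) (use assms in \<open>auto simp: G_def\<close>)
  then show ?thesis
    unfolding B by (simp add: prod.reindex[OF inj] G cart_eq_inner_axis[symmetric] o_def)
qed

text \<open>The half-open interval comes from the fundamental domain of the torus. It differs from
  \<open>{0..1}\<close> by a null set, and there the antiderivative has equal values at both ends
  because \<open>m\<close> is an integer.\<close>

lemma integral_unit_interval_cis:
  fixes m :: int
  shows "integrable lborel (\<lambda>x. indicator {0..<1} x *\<^sub>R cis (2 * pi * (of_int m * x)))"
    and "m \<noteq> 0 \<Longrightarrow> (\<integral>x. indicator {0..<1} x *\<^sub>R cis (2 * pi * (of_int m * x)) \<partial>lborel) = 0"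
proof -
  let ?f = "\<lambda>x. cis (2 * pi * (of_int m * x))"
  have [measurable]: "?f \<in> borel_measurable borel"
    by (intro borel_measurable_continuous_onI continuous_intros)
  have ae: "AE x in lborel. indicator {0..<1::real} x *\<^sub>R ?f x = indicator {0..1} x *\<^sub>R ?f x"
    using AE_lborel_singleton[of "1::real"] by eventually_elim (auto simp: indicator_def)
  have i: "integrable lborel (\<lambda>x. indicator {0..1} x *\<^sub>R ?f x)"
    by (intro borel_integrable_compact continuous_intros) simp
  show "integrable lborel (\<lambda>x. indicator {0..<1} x *\<^sub>R ?f x)"
    by (subst integrable_cong_AE[OF _ _ ae]) (use i in simp_all)
  assume m: "m \<noteq> 0"
  let ?F = "\<lambda>x. ?f x / (2 * pi * m * \<i>)"
  have "has_bochner_integral lborel (\<lambda>x. indicator {0..1} x *\<^sub>R ?f x) (?F 1 - ?F 0)"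
  proof (rule has_bochner_integral_FTC_Icc)
    show "(?F has_vector_derivative ?f x) (at x within {0..1})" for x
    proof -
      have "((\<lambda>z. exp (2 * pi * m * \<i> * z) / (2 * pi * m * \<i>)) has_field_derivative
          exp (2 * pi * m * \<i> * complex_of_real x)) (at (complex_of_real x))"
        using m by (auto intro!: derivative_eq_intros)
      from has_vector_derivative_real_field[OF this, of "{0..1}"]
      show ?thesis
        unfolding cis_conv_exp by (simp add: o_def mult_ac)
    qed
    show "continuous_on {0..1} ?f" by (intro continuous_intros)
  qed simp
  moreover have "?f 1 = 1" using cis_multiple_2pi[of "of_int m"] by (simp add: mult.commute)
  ultimately have "(\<integral>x. indicator {0..1} x *\<^sub>R ?f x \<partial>lborel) = 0"
    by (simp add: has_bochner_integral_integral_eq)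
  then show "(\<integral>x. indicator {0..<1} x *\<^sub>R ?f x \<partial>lborel) = 0"
    by (subst integral_cong_AE[OF _ _ ae]) simp_all
qed

text \<open>On the unit cube both the indicator and the character factor over the coordinates; the
  factor of a coordinate with \<open>k $ i \<noteq> 0\<close> vanishes.\<close>

lemma integral_character:
  assumes "k \<noteq> 0"
  shows "(LINT x|torus_measure. character k (x :: ('d::finite) torus)) = 0"
proof -
  let ?C = "{x :: real ^ 'd. \<forall>i. 0 \<le> x $ i \<and> x $ i < 1}"
  have "?C = (\<Inter>i. {x. 0 \<le> x $ i} \<inter> {x. x $ i < 1})" by auto
  also have "\<dots> \<in> sets lborel" by measurable
  finally have C: "?C \<in> sets lborel" .
  have p: "torus_proj \<in> borel_measurable (restrict_space lborel ?C)"
    by (rule measurable_restrict_space1) simp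
  have c: "character k \<in> borel_measurable borel"
    by (intro borel_measurable_continuous_onI continuous_on_character)
  let ?g = "\<lambda>i x. indicator {0..<1} x *\<^sub>R cis (2 * pi * (of_int (k $ i) * x))"
  have "(LINT x|torus_measure. character k (x :: 'd torus)) = (LINT x|restrict_space lborel ?C. character k (torus_proj x))"
    unfolding torus_measure_def by (rule integral_distr[OF p c])
  also have "\<dots> = (LINT x|lborel. indicator ?C x *\<^sub>R character k (torus_proj x))"
    using C by (subst integral_restrict_space) simp_all
  also have "\<dots> = (LINT x|lborel. (\<Prod>i\<in>UNIV. ?g i (x $ i)))"
  proof (intro Bochner_Integration.integral_cong refl)
    fix x :: "real ^ 'd"
    have "character k (torus_proj x) = (\<Prod>i\<in>UNIV. cis (2 * pi * (of_int (k $ i) * x $ i)))"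
      unfolding character.abs_eq cis_conv_exp by (simp add: exp_sum[symmetric] sum_distrib_left)
    moreover have "(indicator ?C x :: complex) = (\<Prod>i\<in>UNIV. indicator {0..<1} (x $ i))"
      by (auto simp: indicator_def intro!: prod.neutral)
    ultimately show "indicator ?C x *\<^sub>R character k (torus_proj x) = (\<Prod>i\<in>UNIV. ?g i (x $ i))"
      by (simp add: prod.distrib scaleR_conv_of_real of_real_indicator)
  qed
  also have "\<dots> = (\<Prod>i\<in>UNIV. integral\<^sup>L lborel (?g i))"
    by (rule integral_lborel_prod_cart) (rule integral_unit_interval_cis)
  also have "\<dots> = 0"
  proof -
    obtain i where "k $ i \<noteq> 0" using assms by (auto simp: vec_eq_iff)
    then show ?thesis by (intro prod_zero bexI[of _ i]) (simp_all add: integral_unit_interval_cis(2))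
  qed
  finally show ?thesis .
qed

lemma square_integrable_character: "square_integrable (character k)"
  using L2_rel_refl_iff fourier_mode.rsp by (auto simp: rel_fun_def eq_onp_def)

lemma character_mult_cnj:
  fixes x :: "('d::finite) torus"
  shows "character k x * cnj (character l x) = character (k - l) x"
proof -
  have "character k (torus_proj y) * cnj (character l (torus_proj y)) = character (k - l) (torus_proj y)"
    for y :: "real ^ 'd"
    unfolding character.abs_eq cis_cnj cis_mult
    by (rule arg_cong[where f=cis]) (simp add: left_diff_distrib right_diff_distrib sum_subtractf)
  from this[of "rep_torus x"] show ?thesis by simp
qed

lemma fourier_mode_orthonormal: "L2_inner (fourier_mode k) (fourier_mode l) = (if k = l then 1 else 0)"
proof -
  have "L2_inner (fourier_mode k) (fourier_mode l) = (LINT x|torus_measure. character k x * cnj (character l x))"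
    unfolding fourier_mode_def by (simp add: L2_inner.abs_eq L2_rel_refl_iff square_integrable_character)
  also have "\<dots> = (LINT x|torus_measure. character (k - l) x)"
    by (simp add: character_mult_cnj)
  also have "\<dots> = (if k = l then 1 else 0)"
  proof (cases "k = l")
    case True
    \<comment> \<open>\<open>character 0 x\<close> equals
      \<open>character 0 x * cnj (character 0 x)\<close>, its own squared modulus.\<close>
    have "character 0 x = 1" for x :: "'a torus"
      using character_mult_cnj[of 0 x 0] complex_norm_square[of "character 0 x"]
      by (metis diff_self norm_character of_real_1 one_power2)
    then show ?thesis using True by (simp add: measure_def finite_measure_torus)
  qed (simp add: integral_character)
  finally show ?thesis .
qed

section \<open>The free Schroedinger group and the free field\<close>

text \<open>By Pythagoras the distance of nested partial sums is governed by the convergent sum of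
  squared norms. The partial sums are therefore Cauchy along the filter of finite subsets, and
  completeness gives the limit.\<close>

lemma orthogonal_summable_on:
  fixes g :: "'i \<Rightarrow> 'a::{real_inner, banach}"
  assumes orth: "pairwise (\<lambda>i j. orthogonal (g i) (g j)) A"
    and bound: "\<And>F. finite F \<Longrightarrow> F \<subseteq> A \<Longrightarrow> (\<Sum>i\<in>F. (norm (g i))\<^sup>2) \<le> B"
  shows "g summable_on A"
proof -
  have pyth: "(norm (\<Sum>i\<in>F. g i))\<^sup>2 = (\<Sum>i\<in>F. (norm (g i))\<^sup>2)" if "finite F" "F \<subseteq> A" for F
    using norm_sum_Pythagorean[OF that(1) pairwise_subset[OF orth that(2)]] .
  have "(\<lambda>i. (norm (g i))\<^sup>2) summable_on A"
    by (rule nonneg_bdd_above_summable_on) (auto intro!: bdd_aboveI[of _ B] bound)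
  then obtain L where lim: "((\<lambda>F. \<Sum>i\<in>F. (norm (g i))\<^sup>2) \<longlongrightarrow> L) (finite_subsets_at_top A)"
    unfolding has_sum_def summable_on_def by blast
  have "\<exists>P. eventually P (finite_subsets_at_top A) \<and> (\<forall>F F'. P F \<and> P F' \<longrightarrow> dist (sum g F) (sum g F') < e)"
    if "e > 0" for e
  proof -
    \<comment> \<open>Two sums within \<open>d\<close> of \<open>L\<close> differ by less than
      \<open>2 * d\<close>, which is \<open>(e / 2)\<^sup>2\<close>.\<close>
    define d where "d = e\<^sup>2 / 8"
    have "d > 0" using that by (simp add: d_def)
    from tendstoD[OF lim this] obtain F0 where F0: "finite F0" "F0 \<subseteq> A"
      and "\<forall>F. finite F \<and> F0 \<subseteq> F \<and> F \<subseteq> A \<longrightarrow> dist (\<Sum>i\<in>F. (norm (g i))\<^sup>2) L < d"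
      unfolding eventually_finite_subsets_at_top by (elim exE conjE)
    then have near: "dist (\<Sum>i\<in>F. (norm (g i))\<^sup>2) L < d" if "finite F" "F0 \<subseteq> F" "F \<subseteq> A" for F
      using that by simp
    have tail: "dist (sum g F) (sum g F0) < e / 2" if F: "finite F" "F0 \<subseteq> F" "F \<subseteq> A" for F
    proof -
      have "(dist (sum g F) (sum g F0))\<^sup>2 = (norm (sum g (F - F0)))\<^sup>2"
        unfolding dist_norm using F by (subst sum_diff) auto
      also have "\<dots> = (\<Sum>i\<in>F - F0. (norm (g i))\<^sup>2)"
        using F by (intro pyth) auto
      also have "\<dots> = (\<Sum>i\<in>F. (norm (g i))\<^sup>2) - (\<Sum>i\<in>F0. (norm (g i))\<^sup>2)"
        using F by (intro sum_diff) auto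
      also have "\<dots> < 2 * d"
        using near[OF F] near[OF F0(1) subset_refl F0(2)] unfolding dist_real_def by linarith
      also have "\<dots> = (e / 2)\<^sup>2" by (simp add: d_def power2_eq_square)
      finally show ?thesis by (rule power_less_imp_less_base) (use \<open>e > 0\<close> in simp)
    qed
    have "eventually (\<lambda>F. dist (sum g F) (sum g F0) < e / 2) (finite_subsets_at_top A)"
      unfolding eventually_finite_subsets_at_top
      by (intro exI[of _ F0] conjI F0 allI impI tail) auto
    moreover have "dist (sum g F) (sum g F') < e"
      if "dist (sum g F) (sum g F0) < e / 2" "dist (sum g F') (sum g F0) < e / 2" for F F'
      using that dist_triangle_half_l[of "sum g F" "sum g F0" e "sum g F'"] by blast
    ultimately show ?thesis
      by (intro exI[of _ "\<lambda>F. dist (sum g F) (sum g F0) < e / 2"]) simp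
  qed
  then have "cauchy_filter (filtermap (sum g) (finite_subsets_at_top A))"
    by (simp add: cauchy_filter_metric_filtermap)
  moreover have "complete (UNIV :: 'a set)"
    by (meson Cauchy_convergent UNIV_I complete_def convergent_def)
  ultimately obtain l where "(sum g \<longlongrightarrow> l) (finite_subsets_at_top A)"
    using complete_uniform[where S=UNIV] by (force simp add: filterlim_def)
  then show ?thesis unfolding summable_on_def has_sum_def by blast
qed

text \<open>The bound holds for finite partial sums by Pythagoras and survives in the limit.\<close>

lemma orthogonal_infsum_norm_le:
  fixes g :: "'i \<Rightarrow> 'a::{real_inner, banach}"
  assumes orth: "pairwise (\<lambda>i j. orthogonal (g i) (g j)) A"
    and bound: "\<And>F. finite F \<Longrightarrow> F \<subseteq> A \<Longrightarrow> (\<Sum>i\<in>F. (norm (g i))\<^sup>2) \<le> B\<^sup>2" and "B \<ge> 0"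
  shows "norm (infsum g A) \<le> B"
proof -
  have "(g has_sum infsum g A) A"
    by (intro has_sum_infsum orthogonal_summable_on[OF orth bound])
  then have "((\<lambda>F. norm (sum g F)) \<longlongrightarrow> norm (infsum g A)) (finite_subsets_at_top A)"
    unfolding has_sum_def by (rule tendsto_norm)
  then show ?thesis
  proof (rule tendsto_upperbound)
    have "norm (sum g F) \<le> B" if F: "finite F" "F \<subseteq> A" for F
    proof (rule power2_le_imp_le)
      show "(norm (sum g F))\<^sup>2 \<le> B\<^sup>2"
        using norm_sum_Pythagorean[OF F(1) pairwise_subset[OF orth F(2)]] bound[OF F] by simp
    qed fact
    then show "\<forall>\<^sub>F F in finite_subsets_at_top A. norm (sum g F) \<le> B"
      by (rule eventually_finite_subsets_at_top_weakI)
  qed simp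
qed

section \<open>Bessel's inequality for the Fourier modes\<close>

lemma norm_fourier_mode [simp]: "norm (fourier_mode k) = 1"
  by (simp add: norm_eq_sqrt_inner inner_L2_def fourier_mode_orthonormal)

lemma orthogonal_fourier_modes:
  "pairwise (\<lambda>k l. orthogonal (L2_scale (a k) (fourier_mode k)) (L2_scale (b l) (fourier_mode l))) UNIV"
  by (auto simp: pairwise_def orthogonal_def inner_L2_def L2_inner_scale_left L2_inner_scale_right
      fourier_mode_orthonormal)

text \<open>The finite Fourier sum \<open>s\<close> satisfies
  \<open>inner \<psi> s = (norm s)\<^sup>2\<close>; it remains to expand
  \<open>0 \<le> (norm (\<psi> - s))\<^sup>2\<close>.\<close>

lemma bessel_fourier:
  assumes "finite F"
  shows "(\<Sum>k\<in>F. (cmod (L2_inner \<psi> (fourier_mode k)))\<^sup>2) \<le> (norm \<psi>)\<^sup>2"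
proof -
  let ?c = "\<lambda>k. L2_inner \<psi> (fourier_mode k)"
  define s where "s = (\<Sum>k\<in>F. L2_scale (?c k) (fourier_mode k))"
  have s: "(norm s)\<^sup>2 = (\<Sum>k\<in>F. (cmod (?c k))\<^sup>2)"
    unfolding s_def
    by (subst norm_sum_Pythagorean[OF assms pairwise_subset[OF orthogonal_fourier_modes]])
      (simp_all add: norm_L2_scale)
  have "inner \<psi> (L2_scale (?c k) (fourier_mode k)) = (cmod (?c k))\<^sup>2" for k
    unfolding inner_L2_def L2_inner_scale_right
    by (simp add: mult.commute[of "cnj _"] complex_norm_square[symmetric] del: of_real_power)
  then have "inner \<psi> s = (norm s)\<^sup>2"
    unfolding s by (simp add: s_def inner_sum_right)
  moreover have "0 \<le> (norm (\<psi> - s))\<^sup>2" by simp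
  ultimately have "(norm s)\<^sup>2 \<le> (norm \<psi>)\<^sup>2"
    by (simp add: power2_norm_eq_inner inner_diff_left inner_diff_right inner_commute)
  then show ?thesis by (simp only: s)
qed

section \<open>The Schroedinger group: convergence, contraction, adjoint\<close>

abbreviation schroedinger_mode :: "real \<Rightarrow> ('d::finite) L2 \<Rightarrow> int ^ 'd \<Rightarrow> 'd L2"
  where "schroedinger_mode t \<psi> k \<equiv>
    L2_scale (exp (\<i> * t * laplacian_eigenvalue k / 2) * L2_inner \<psi> (fourier_mode k)) (fourier_mode k)"

lemma norm_schroedinger_mode: "norm (schroedinger_mode t \<psi> k) = cmod (L2_inner \<psi> (fourier_mode k))"
proof -
  have "cmod (exp (\<i> * t * laplacian_eigenvalue k / 2)) = 1"
    using norm_exp_i_times[of "t * laplacian_eigenvalue k / 2"] by (simp add: mult.assoc)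
  then show ?thesis by (simp add: norm_L2_scale norm_mult)
qed

text \<open>\<open>infsum\<close> is 0 by convention for a family that is not summable, so
  convergence comes first. The phases have modulus 1, and Bessel's inequality bounds the squared
  norms of the orthogonal terms.\<close>

lemma schroedinger_group_has_sum: "(schroedinger_mode t \<psi> has_sum schroedinger_group t \<psi>) UNIV"
  unfolding schroedinger_group_def
  by (intro has_sum_infsum orthogonal_summable_on[OF orthogonal_fourier_modes, where B="(norm \<psi>)\<^sup>2"])
    (simp add: norm_schroedinger_mode bessel_fourier)

lemma norm_schroedinger_group_le: "norm (schroedinger_group t \<psi>) \<le> norm \<psi>"
  unfolding schroedinger_group_def
  by (intro orthogonal_infsum_norm_le[OF orthogonal_fourier_modes])
    (simp_all add: norm_schroedinger_mode bessel_fourier)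

lemma schroedinger_group_diff:
  "schroedinger_group t (\<psi> - \<eta>) = schroedinger_group t \<psi> - schroedinger_group t \<eta>"
proof (rule has_sum_unique)
  show "(schroedinger_mode t (\<psi> - \<eta>) has_sum schroedinger_group t (\<psi> - \<eta>)) UNIV"
    by (rule schroedinger_group_has_sum)
  have "schroedinger_mode t (\<psi> - \<eta>) = (\<lambda>k. schroedinger_mode t \<psi> k + - schroedinger_mode t \<eta> k)"
    by (simp add: L2_inner.diff_left right_diff_distrib L2_scale.diff_left fun_eq_iff)
  moreover have "((\<lambda>k. schroedinger_mode t \<psi> k + - schroedinger_mode t \<eta> k)
      has_sum schroedinger_group t \<psi> + - schroedinger_group t \<eta>) UNIV"
    by (intro has_sum_add schroedinger_group_has_sum)
      (simp only: has_sum_uminus minus_minus schroedinger_group_has_sum)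
  ultimately show "(schroedinger_mode t (\<psi> - \<eta>) has_sum schroedinger_group t \<psi> - schroedinger_group t \<eta>) UNIV"
    by simp
qed

text \<open>Conjugating the phase of a mode reverses time, and continuity of the inner product lets
  both sides be compared mode by mode.\<close>

lemma schroedinger_group_adjoint_neg:
  "L2_inner (schroedinger_group t \<psi>) \<eta> = L2_inner \<psi> (schroedinger_group (- t) \<eta>)"
proof (rule has_sum_unique)
  have "cnj (exp (\<i> * complex_of_real (- t) * complex_of_real r / 2)) = exp (\<i> * t * r / 2)" for r
    unfolding exp_cnj by simp
  then have eq: "L2_inner \<psi> (schroedinger_mode (- t) \<eta> k) = L2_inner (schroedinger_mode t \<psi> k) \<eta>" for k
    unfolding L2_inner_scale_left L2_inner_scale_right complex_cnj_mult L2_inner_commute[of "fourier_mode k" \<eta>]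
    by (simp only: mult.assoc mult.commute[of "L2_inner \<psi> (fourier_mode k)"])
  show "((\<lambda>k. L2_inner (schroedinger_mode t \<psi> k) \<eta>) has_sum L2_inner (schroedinger_group t \<psi>) \<eta>) UNIV"
    by (rule has_sum_bounded_linear[OF L2_inner.bounded_linear_left schroedinger_group_has_sum])
  have "((\<lambda>k. L2_inner \<psi> (schroedinger_mode (- t) \<eta> k)) has_sum L2_inner \<psi> (schroedinger_group (- t) \<eta>)) UNIV"
    by (rule has_sum_bounded_linear[OF L2_inner.bounded_linear_right schroedinger_group_has_sum])
  then show "((\<lambda>k. L2_inner (schroedinger_mode t \<psi> k) \<eta>) has_sum L2_inner \<psi> (schroedinger_group (- t) \<eta>)) UNIV"
    unfolding eq .
qed

text \<open>\<open>L2_adjoint\<close> is defined by choice; the group at time \<open>- t\<close> is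
  a witness, so the chosen operator has the adjoint property.\<close>

lemma L2_inner_adjoint_schroedinger_group:
  fixes \<psi> \<eta> :: "('d::finite) L2"
  shows "L2_inner (schroedinger_group t \<psi>) \<eta> = L2_inner \<psi> (L2_adjoint (schroedinger_group t) \<eta>)"
proof -
  have "\<forall>(\<psi> :: 'd L2) \<eta>. L2_inner (schroedinger_group t \<psi>) \<eta> = L2_inner \<psi> (L2_adjoint (schroedinger_group t) \<eta>)"
    unfolding L2_adjoint_def
    by (rule someI[of _ "schroedinger_group (- t)"]) (intro allI schroedinger_group_adjoint_neg)
  then show ?thesis by simp
qed

section \<open>Multiplication by a real potential\<close>

lemma L2_cases:
  obtains f where "square_integrable f" "\<psi> = abs_L2 f"
  using L2_rep by metis

lemma square_integrable_potential:
  "square_integrable f \<Longrightarrow> square_integrable (\<lambda>x. complex_of_real (apply_bcontfun V x) * f x)"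
  using norm_bounded[of V]
  by (intro square_integrable_mult_bounded[where B="norm V"] borel_measurable_bcontfun) simp_all

lemma L2_potential_abs_L2:
  "square_integrable f \<Longrightarrow>
    L2_potential V (abs_L2 f) = abs_L2 (\<lambda>x. complex_of_real (apply_bcontfun V x) * f x)"
  by (simp add: L2_potential.abs_eq L2_rel_refl_iff)

lemma L2_potential_diff_left: "L2_potential (V - W) \<psi> = L2_potential V \<psi> - L2_potential W \<psi>"
proof -
  obtain f where "square_integrable f" "\<psi> = abs_L2 f" by (rule L2_cases)
  then show ?thesis
    by (simp add: L2_potential_abs_L2 abs_L2_diff square_integrable_potential left_diff_distrib)
qed

lemma L2_potential_diff_right: "L2_potential V (\<psi> - \<eta>) = L2_potential V \<psi> - L2_potential V \<eta>"
proof -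
  obtain f where "square_integrable f" "\<psi> = abs_L2 f" by (rule L2_cases)
  moreover obtain g where "square_integrable g" "\<eta> = abs_L2 g" by (rule L2_cases)
  ultimately show ?thesis
    by (simp add: L2_potential_abs_L2 abs_L2_diff square_integrable_potential square_integrable_diff
        right_diff_distrib)
qed

lemma norm_L2_potential_le: "norm (L2_potential V \<psi>) \<le> norm V * norm \<psi>"
proof -
  obtain f where f: "square_integrable f" "\<psi> = abs_L2 f" by (rule L2_cases)
  have "(norm (L2_potential V \<psi>))\<^sup>2 = (LINT x|torus_measure. (cmod (complex_of_real (apply_bcontfun V x) * f x))\<^sup>2)"
    unfolding f(2) L2_potential_abs_L2[OF f(1)] by (rule norm_abs_L2[OF square_integrable_potential[OF f(1)]])
  also have "\<dots> \<le> (LINT x|torus_measure. (norm V)\<^sup>2 * (cmod (f x))\<^sup>2)"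
  proof (rule integral_mono)
    show "(cmod (complex_of_real (apply_bcontfun V x) * f x))\<^sup>2 \<le> (norm V)\<^sup>2 * (cmod (f x))\<^sup>2" for x
      using norm_bounded[of V x] power_mono[of "\<bar>apply_bcontfun V x\<bar>" "norm V" 2]
      by (simp add: norm_mult power_mult_distrib mult_right_mono)
  qed (use f(1) square_integrable_potential[OF f(1)] in \<open>simp_all add: square_integrable_def\<close>)
  also have "\<dots> = (norm V * norm \<psi>)\<^sup>2"
    by (simp add: f(2) norm_abs_L2[OF f(1)] power_mult_distrib)
  finally show ?thesis by (rule power2_le_imp_le) simp
qed

text \<open>For real \<open>V\<close> the inner product is the integral of \<open>V\<close> against
  the squared modulus of the state. After division by \<open>\<i> * hbar\<close>, a common potential
  acting on the difference of two states thus leaves their distance unchanged.\<close>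

lemma Im_L2_inner_potential: "Im (L2_inner (L2_potential V \<psi>) \<psi>) = 0"
proof -
  obtain f where f: "square_integrable f" "\<psi> = abs_L2 f" by (rule L2_cases)
  have "(\<lambda>x. complex_of_real (apply_bcontfun V x) * f x * cnj (f x))
      = (\<lambda>x. complex_of_real (apply_bcontfun V x * (cmod (f x))\<^sup>2))"
    unfolding of_real_mult complex_norm_square by (simp only: mult.assoc)
  then have "L2_inner (L2_potential V \<psi>) \<psi>
      = complex_of_real (LINT x|torus_measure. apply_bcontfun V x * (cmod (f x))\<^sup>2)"
    unfolding f(2) L2_potential_abs_L2[OF f(1)]
    by (subst L2_inner.abs_eq)
      (simp_all only: L2_rel_refl_iff f(1) square_integrable_potential integral_complex_of_real)
  then show ?thesis by simp
qed

text \<open>Once the adjoint is moved to the other side, the potential terms split as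
  \<open>V\<^sub>1\<close> on \<open>a - b\<close> plus \<open>V\<^sub>1 - V\<^sub>2\<close> on
  \<open>b\<close>. The first part drops out because \<open>V\<^sub>1\<close> is real; the second is
  bounded by Cauchy-Schwarz and contractivity.\<close>

lemma inner_free_field_diff_le:
  assumes "hbar > 0"
  shows "inner (free_field hbar t \<phi>\<^sub>1 V\<^sub>1 - free_field hbar t \<phi>\<^sub>2 V\<^sub>2) (\<phi>\<^sub>1 - \<phi>\<^sub>2)
    \<le> norm (V\<^sub>1 - V\<^sub>2) / hbar * norm \<phi>\<^sub>2 * norm (\<phi>\<^sub>1 - \<phi>\<^sub>2)"
proof -
  let ?U = "schroedinger_group (hbar * t)"
  let ?S = "L2_adjoint ?U"
  define a where "a = ?U \<phi>\<^sub>1"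
  define b where "b = ?U \<phi>\<^sub>2"
  have adj: "L2_inner (?S \<zeta>) \<psi> = L2_inner \<zeta> (?U \<psi>)" for \<zeta> \<psi>
    using L2_inner_adjoint_schroedinger_group[of "hbar * t" \<psi> \<zeta>] by (metis L2_inner_commute)
  have U: "?U (\<phi>\<^sub>1 - \<phi>\<^sub>2) = a - b" by (simp add: a_def b_def schroedinger_group_diff)
  have "L2_inner (free_field hbar t \<phi>\<^sub>1 V\<^sub>1 - free_field hbar t \<phi>\<^sub>2 V\<^sub>2) (\<phi>\<^sub>1 - \<phi>\<^sub>2)
      = (1 / (\<i> * hbar)) * L2_inner (L2_potential V\<^sub>1 a - L2_potential V\<^sub>2 b) (a - b)"
    unfolding free_field_def L2_inner.diff_left L2_inner_scale_left adj U a_def[symmetric] b_def[symmetric]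
    by (simp add: right_diff_distrib)
  also have "L2_potential V\<^sub>1 a - L2_potential V\<^sub>2 b = L2_potential V\<^sub>1 (a - b) + L2_potential (V\<^sub>1 - V\<^sub>2) b"
    by (simp add: L2_potential_diff_left L2_potential_diff_right)
  finally have *: "L2_inner (free_field hbar t \<phi>\<^sub>1 V\<^sub>1 - free_field hbar t \<phi>\<^sub>2 V\<^sub>2) (\<phi>\<^sub>1 - \<phi>\<^sub>2)
      = (1 / (\<i> * hbar)) * (L2_inner (L2_potential V\<^sub>1 (a - b)) (a - b) + L2_inner (L2_potential (V\<^sub>1 - V\<^sub>2) b) (a - b))"
    by (simp only: L2_inner.add_left)
  \<comment> \<open>Division by \<open>\<i> * hbar\<close> turns the real part of the inner product
    into its imaginary part over \<open>hbar\<close>.\<close>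
  have "1 / (\<i> * hbar) = - \<i> * complex_of_real (1 / hbar)"
    using assms by (simp add: field_simps)
  then have "Re ((1 / (\<i> * hbar)) * z) = Im z / hbar" for z
    by (simp only:) simp
  then have eq: "inner (free_field hbar t \<phi>\<^sub>1 V\<^sub>1 - free_field hbar t \<phi>\<^sub>2 V\<^sub>2) (\<phi>\<^sub>1 - \<phi>\<^sub>2)
      = Im (L2_inner (L2_potential (V\<^sub>1 - V\<^sub>2) b) (a - b)) / hbar"
    unfolding inner_L2_def * by (simp only: plus_complex.sel Im_L2_inner_potential add_0_left)
  have "Im (L2_inner (L2_potential (V\<^sub>1 - V\<^sub>2) b) (a - b)) \<le> norm (L2_potential (V\<^sub>1 - V\<^sub>2) b) * norm (a - b)"
    using abs_Im_le_cmod norm_L2_inner_le by (meson abs_le_D1 order_trans)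
  also have "\<dots> \<le> (norm (V\<^sub>1 - V\<^sub>2) * norm \<phi>\<^sub>2) * norm (\<phi>\<^sub>1 - \<phi>\<^sub>2)"
  proof (intro mult_mono)
    have "norm b \<le> norm \<phi>\<^sub>2" unfolding b_def by (rule norm_schroedinger_group_le)
    then show "norm (L2_potential (V\<^sub>1 - V\<^sub>2) b) \<le> norm (V\<^sub>1 - V\<^sub>2) * norm \<phi>\<^sub>2"
      by (rule order_trans[OF norm_L2_potential_le mult_left_mono]) simp
    show "norm (a - b) \<le> norm (\<phi>\<^sub>1 - \<phi>\<^sub>2)"
      unfolding U[symmetric] by (rule norm_schroedinger_group_le)
  qed simp_all
  finally have "Im (L2_inner (L2_potential (V\<^sub>1 - V\<^sub>2) b) (a - b)) / hbar
      \<le> (norm (V\<^sub>1 - V\<^sub>2) * norm \<phi>\<^sub>2) * norm (\<phi>\<^sub>1 - \<phi>\<^sub>2) / hbar"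
    using assms by (intro divide_right_mono) simp_all
  then show ?thesis unfolding eq by simp
qed

section \<open>Supports of measures on the phase space\<close>

text \<open>Coordinatewise fractional parts represent every point in the closed unit cube, so the
  torus is a continuous image of a compact set.\<close>

lemma compact_torus: "compact (UNIV :: ('d::finite) torus set)"
proof -
  have "t \<in> torus_proj ` cbox 0 1" for t :: "'d torus"
  proof
    let ?y = "\<chi> i. frac (rep_torus t $ i)"
    show "?y \<in> cbox 0 1"
      by (simp add: mem_box_cart frac_lt_1 less_imp_le)
    have "lattice_equiv (rep_torus t) ?y"
      by (simp add: lattice_equiv_def frac_def)
    then show "t = torus_proj ?y"
      by (metis torus_proj_eq_iff torus_proj_rep)
  qed
  then have "(UNIV :: 'd torus set) = torus_proj ` cbox 0 1" by blast
  then show ?thesis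
    by (metis compact_cbox compact_continuous_image continuous_on_subset continuous_on_torus_proj subset_UNIV)
qed

text \<open>A code consists of finitely many basic open sets with a rational value for each, and a
  precision. There are countably many codes; by compactness every function satisfies a code of any
  precision, and two functions satisfying the same code are uniformly close. One function is chosen
  per code.\<close>

lemma countable_dense_bcontfun:
  assumes "compact (UNIV :: 'a::second_countable_topology set)"
  shows "\<exists>D :: ('a \<Rightarrow>\<^sub>C real) set. countable D \<and> closure D = UNIV"
proof -
  obtain B :: "'a set set" where B: "countable B" "topological_basis B"
    using ex_countable_basis by blast
  define F :: "('a set \<times> rat) list \<Rightarrow> nat \<Rightarrow> ('a \<Rightarrow>\<^sub>C real) set"
    where "F xs n = {f. (\<forall>x. \<exists>p\<in>set xs. x \<in> fst p) \<and>
      (\<forall>p\<in>set xs. \<forall>x\<in>fst p. dist (apply_bcontfun f x) (of_rat (snd p)) < inverse (real (Suc n)))}" for xs n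
  \<comment> \<open>For a code that no function satisfies, \<open>SOME\<close> yields an arbitrary
    function, which harms neither countability nor density.\<close>
  define D where "D = (\<lambda>(xs, n). SOME f. f \<in> F xs n) ` (lists (B \<times> UNIV) \<times> UNIV)"
  have "countable D"
    unfolding D_def using B(1) by (intro countable_image countable_SIGMA countable_lists) simp_all
  moreover have "f \<in> closure D" for f
    unfolding closure_approachable
  proof (intro allI impI)
    fix e :: real assume "e > 0"
    then obtain n where n: "inverse (real (Suc n)) < e / 2"
      using reals_Archimedean[of "e / 2"] by auto
    define r where "r = inverse (real (Suc n))"
    have "r > 0" by (simp add: r_def)
    have "\<exists>p\<in>B \<times> UNIV. x \<in> fst p \<and> (\<forall>y\<in>fst p. dist (apply_bcontfun f y) (of_rat (snd p)) < r)" for x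
    proof -
      obtain q where q: "apply_bcontfun f x < of_rat q" "of_rat q < apply_bcontfun f x + r"
        using of_rat_dense[of "apply_bcontfun f x" "apply_bcontfun f x + r"] \<open>r > 0\<close> by auto
      have "open (apply_bcontfun f -` ball (of_rat q) r)"
        by (intro open_vimage continuous_on_apply_bcontfun open_ball)
      moreover have "x \<in> apply_bcontfun f -` ball (of_rat q) r"
        using q by (simp add: dist_real_def)
      ultimately obtain b where "b \<in> B" "x \<in> b" "b \<subseteq> apply_bcontfun f -` ball (of_rat q) r"
        by (rule topological_basisE[OF B(2)])
      then show ?thesis
        by (intro bexI[of _ "(b, q)"]) (auto simp: dist_commute)
    qed
    then obtain p where p: "\<And>x. p x \<in> B \<times> UNIV" "\<And>x. x \<in> fst (p x)"
      "\<And>x y. y \<in> fst (p x) \<Longrightarrow> dist (apply_bcontfun f y) (of_rat (snd (p x))) < r"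
      by metis
    obtain C where C: "finite C" "UNIV \<subseteq> (\<Union>x\<in>C. fst (p x))"
    proof (rule compactE_image[OF assms, of UNIV "\<lambda>x. fst (p x)"])
      show "open (fst (p x))" for x
        using p(1)[of x] topological_basis_open[OF B(2)] by (auto simp: mem_Times_iff)
    qed (use p(2) in auto)
    obtain xs where xs: "set xs = p ` C"
      using finite_list[OF finite_imageI[OF C(1)], of p] by (elim exE)
    have "\<exists>q\<in>p ` C. x \<in> fst q" for x
      using subsetD[OF C(2) UNIV_I[of x]] by blast
    moreover have "dist (apply_bcontfun f x) (of_rat (snd q)) < r" if "q \<in> p ` C" "x \<in> fst q" for q x
      using that p(3) by blast
    ultimately have f: "f \<in> F xs n"
      unfolding F_def xs r_def by simp
    define g where "g = (SOME f. f \<in> F xs n)"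
    have g: "g \<in> F xs n" unfolding g_def by (rule someI[where P="\<lambda>f. f \<in> F xs n"]) (rule f)
    have "xs \<in> lists (B \<times> UNIV)"
      unfolding in_lists_conv_set xs using p(1) by blast
    then have "g \<in> D"
      unfolding D_def g_def by (intro image_eqI[of _ _ "(xs, n)"]) simp_all
    \<comment> \<open>At each point both functions lie within \<open>r\<close> of the rational value
      of some covering set.\<close>
    moreover have "dist g f \<le> 2 * r"
    proof (rule dist_bound)
      fix x
      have "\<exists>c\<in>set xs. x \<in> fst c" using f by (simp add: F_def)
      then obtain c where c: "c \<in> set xs" "x \<in> fst c" by blast
      have "dist (apply_bcontfun h x) (of_rat (snd c)) < r" if "h \<in> F xs n" for h
        using that c by (simp add: F_def r_def)
      from this[OF f] this[OF g] show "dist (apply_bcontfun g x) (apply_bcontfun f x) \<le> 2 * r"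
        unfolding dist_real_def by linarith
    qed
    ultimately show "\<exists>g\<in>D. dist g f < e"
      using n by (intro bexI[of _ g]) (simp_all add: r_def)
  qed
  ultimately show ?thesis by blast
qed

lemma countable_dense_phase: "\<exists>D :: ('d::finite) phase set. countable D \<and> closure D = UNIV"
proof -
  obtain E :: "('d torus \<Rightarrow>\<^sub>C real) set" where E: "countable E" "closure E = UNIV"
    using countable_dense_bcontfun[OF compact_torus] by blast
  obtain D :: "'d L2 set" where D: "countable D" "\<And>X. open X \<Longrightarrow> X \<noteq> {} \<Longrightarrow> \<exists>d\<in>D. d \<in> X"
    by (rule countable_dense_setE) blast
  have "x \<in> closure D" for x
    unfolding closure_approachable
  proof (intro allI impI)
    fix e :: real assume "e > 0"
    then show "\<exists>y\<in>D. dist y x < e" using D(2)[of "ball x e"] by (auto simp: dist_commute)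
  qed
  then show ?thesis
    using E D(1) by (intro exI[of _ "D \<times> E"]) (auto simp: closure_Times)
qed

section \<open>Full measure of the support, and closed sets containing it\<close>

lemma open_Int_space_in_sets:
  assumes "sets \<mu> = sets (restrict_space borel Z)" "open U"
  shows "U \<inter> space \<mu> \<in> sets \<mu>"
  using assms sets_eq_imp_space_eq[OF assms(1)]
  by (auto simp: sets_restrict_space space_restrict_space intro!: image_eqI[of _ _ U])

text \<open>A point outside the support has a null neighbourhood, hence lies in a null ball with
  centre in \<open>D\<close> and radius \<open>inverse (real (Suc n))\<close>. There are only
  countably many such balls.\<close>

lemma AE_in_measure_support:
  fixes \<mu> :: "'a::metric_space measure" and D :: "'a set"
  assumes D: "countable D" "closure D = UNIV" and \<mu>: "sets \<mu> = sets (restrict_space borel Z)"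
  shows "AE z in \<mu>. z \<in> measure_support \<mu>"
proof -
  let ?b = "\<lambda>p :: 'a \<times> nat. ball (fst p) (inverse (real (Suc (snd p)))) \<inter> space \<mu>"
  define I where "I = {p \<in> D \<times> UNIV. emeasure \<mu> (?b p) = 0}"
  have "countable I"
    by (rule countable_subset[of _ "D \<times> UNIV"]) (use D(1) in \<open>auto simp: I_def\<close>)
  then have "(\<Union>p\<in>I. ?b p) \<in> null_sets \<mu>"
    by (rule null_sets_UN') (auto simp: I_def null_sets_def open_Int_space_in_sets[OF \<mu>])
  from AE_not_in[OF this] show ?thesis
  proof (rule AE_mp, intro AE_I2 impI)
    fix z assume z: "z \<in> space \<mu>" "z \<notin> (\<Union>p\<in>I. ?b p)"
    have "0 < emeasure \<mu> (U \<inter> space \<mu>)" if U: "open U" "z \<in> U" for U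
    proof -
      obtain e where e: "e > 0" "ball z e \<subseteq> U" using U by (meson open_contains_ball)
      obtain n where n: "inverse (real (Suc n)) < e / 2"
        using reals_Archimedean[of "e / 2"] e(1) by auto
      obtain d where d: "d \<in> D" "dist d z < inverse (real (Suc n))"
        using D(2) closure_approachable[of z D] by (metis UNIV_I inverse_positive_iff_positive of_nat_0_less_iff zero_less_Suc)
      then have "emeasure \<mu> (?b (d, n)) \<noteq> 0" using z by (auto simp: I_def)
      moreover have "?b (d, n) \<subseteq> U \<inter> space \<mu>"
      proof -
        have "dist z y < e" if "dist d y < inverse (real (Suc n))" for y
          using that d(2) n dist_triangle[of z y d] by (simp add: dist_commute)
        then show ?thesis using e(2) by auto
      qed
      then have "emeasure \<mu> (?b (d, n)) \<le> emeasure \<mu> (U \<inter> space \<mu>)"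
        by (intro emeasure_mono open_Int_space_in_sets[OF \<mu> U(1)])
      ultimately show ?thesis by (metis le_zero_eq not_gr_zero)
    qed
    then show "z \<in> measure_support \<mu>" using z(1) by (simp add: measure_support_def)
  qed
qed

text \<open>The complement of \<open>C\<close> is an open null set, which cannot be a neighbourhood
  of a point of the support.\<close>

lemma measure_support_subset_closed:
  assumes \<mu>: "sets \<mu> = sets (restrict_space borel Z)" and "closed C" and "AE z in \<mu>. z \<in> C"
  shows "measure_support \<mu> \<subseteq> C"
proof (rule ccontr)
  assume "\<not> measure_support \<mu> \<subseteq> C"
  then obtain z where z: "z \<in> measure_support \<mu>" "z \<in> - C" by auto
  have "open (- C)" using \<open>closed C\<close> by (simp add: open_Compl)
  then have "0 < emeasure \<mu> (- C \<inter> space \<mu>)" using z by (simp add: measure_support_def)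
  moreover have "- C \<inter> space \<mu> = {z \<in> space \<mu>. \<not> z \<in> C}" by auto
  moreover have "emeasure \<mu> {z \<in> space \<mu>. \<not> z \<in> C} = 0"
    using AE_iff_measurable[OF _ refl, of \<mu> "\<lambda>z. z \<in> C"] assms(3)
      open_Int_space_in_sets[OF \<mu> \<open>open (- C)\<close>] calculation(2) by simp
  ultimately show False by simp
qed

section \<open>The coupling\<close>

text \<open>The left side is \<open>- (Re a + Re b) * (1 - Re c) - (Im a - Im b) * Im c\<close>.
  Closeness to \<open>\<theta>\<close> makes the first term at most
  \<open>(R\<^sup>2 / 2 - 1) * d\<^sup>2\<close>; the imaginary parts cost at most another
  \<open>R\<^sup>2 / 4 * d\<^sup>2\<close>.\<close>

lemma lohe_pointwise:
  assumes n: "norm \<phi>\<^sub>1 = 1" "norm \<phi>\<^sub>2 = 1" "norm \<theta> = 1"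
    and R: "norm (\<phi>\<^sub>1 - \<theta>) \<le> R" "norm (\<phi>\<^sub>2 - \<theta>) \<le> R"
  shows "inner ((\<theta> - L2_scale (L2_inner \<phi>\<^sub>1 \<theta>) \<phi>\<^sub>1) - (\<theta> - L2_scale (L2_inner \<phi>\<^sub>2 \<theta>) \<phi>\<^sub>2)) (\<phi>\<^sub>1 - \<phi>\<^sub>2)
    \<le> (3 / 4 * R\<^sup>2 - 1) * (norm (\<phi>\<^sub>1 - \<phi>\<^sub>2))\<^sup>2"
proof -
  define a where "a = L2_inner \<phi>\<^sub>1 \<theta>"
  define b where "b = L2_inner \<phi>\<^sub>2 \<theta>"
  define c where "c = L2_inner \<phi>\<^sub>1 \<phi>\<^sub>2"
  define d where "d = norm (\<phi>\<^sub>1 - \<phi>\<^sub>2)"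
  have "0 \<le> R" using R(1) norm_ge_zero order_trans by blast
  have sq: "(norm (\<psi> - \<eta>))\<^sup>2 = 2 - 2 * Re (L2_inner \<psi> \<eta>)" if "norm \<psi> = 1" "norm \<eta> = 1" for \<psi> \<eta> :: "'a L2"
    using dot_norm_neg[of \<psi> \<eta>] that by (simp add: inner_L2_def)
  have d2: "d\<^sup>2 = 2 - 2 * Re c" unfolding d_def c_def by (rule sq[OF n(1,2)])
  have ab: "1 - R\<^sup>2 / 2 \<le> Re a" "1 - R\<^sup>2 / 2 \<le> Re b"
    using sq[OF n(1,3)] sq[OF n(2,3)] power_mono[OF R(1) norm_ge_zero, of 2] power_mono[OF R(2) norm_ge_zero, of 2]
    by (simp_all add: a_def b_def)
  \<comment> \<open>The imaginary parts are only of first order in \<open>d\<close> and would cancel the gain \<open>- d\<^sup>2\<close>; they are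
    harmless because they enter as \<open>- (x + y) * y = x\<^sup>2 / 4 - (x / 2 + y)\<^sup>2\<close> with \<open>\<bar>x\<bar> \<le> d * R\<close>.\<close>
  define y where "y = Im c"
  define x where "x = Im (L2_inner (\<phi>\<^sub>1 - \<phi>\<^sub>2) (\<theta> - \<phi>\<^sub>2))"
  have self: "L2_inner \<phi>\<^sub>1 \<phi>\<^sub>1 = 1" "L2_inner \<phi>\<^sub>2 \<phi>\<^sub>2 = 1" using n by (simp_all add: L2_inner_self)
  have x: "x = Im a - Im b - y"
    by (simp add: x_def y_def a_def b_def c_def self L2_inner.diff_left L2_inner.diff_right)
  have "\<bar>x\<bar> \<le> d * R"
  proof -
    have "\<bar>x\<bar> \<le> cmod (L2_inner (\<phi>\<^sub>1 - \<phi>\<^sub>2) (\<theta> - \<phi>\<^sub>2))" unfolding x_def by (rule abs_Im_le_cmod)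
    also have "\<dots> \<le> norm (\<phi>\<^sub>1 - \<phi>\<^sub>2) * norm (\<theta> - \<phi>\<^sub>2)" by (rule norm_L2_inner_le)
    also have "\<dots> \<le> d * R"
      unfolding d_def using R(2) by (intro mult_left_mono) (simp_all add: norm_minus_commute)
    finally show ?thesis .
  qed
  then have x2: "x\<^sup>2 \<le> d\<^sup>2 * R\<^sup>2"
    using power_mono[of "\<bar>x\<bar>" "d * R" 2] by (simp add: power_mult_distrib)
  have "L2_inner \<phi>\<^sub>2 \<phi>\<^sub>1 = cnj c" unfolding c_def by (rule L2_inner_commute)
  then have "L2_inner ((\<theta> - L2_scale a \<phi>\<^sub>1) - (\<theta> - L2_scale b \<phi>\<^sub>2)) (\<phi>\<^sub>1 - \<phi>\<^sub>2) = b * (cnj c - 1) - a * (1 - c)"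
    by (simp add: L2_inner.diff_left L2_inner.diff_right L2_inner_scale_left self c_def[symmetric] algebra_simps)
  then have "inner ((\<theta> - L2_scale a \<phi>\<^sub>1) - (\<theta> - L2_scale b \<phi>\<^sub>2)) (\<phi>\<^sub>1 - \<phi>\<^sub>2)
      = Re (b * (cnj c - 1) - a * (1 - c))"
    unfolding inner_L2_def by (simp only:)
  also have "\<dots> = - (Re a + Re b) * (1 - Re c) - (Im a - Im b) * y"
    by (simp add: y_def algebra_simps)
  also have "\<dots> = - (Re a + Re b) * (d\<^sup>2 / 2) - (x + y) * y"
  proof -
    have "1 - Re c = d\<^sup>2 / 2" "Im a - Im b = x + y" unfolding d2 x by simp_all
    then show ?thesis by (simp only:)
  qed
  also have "\<dots> \<le> (R\<^sup>2 - 2) * (d\<^sup>2 / 2) + x\<^sup>2 / 4"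
  proof -
    have "- (Re a + Re b) * (d\<^sup>2 / 2) \<le> (R\<^sup>2 - 2) * (d\<^sup>2 / 2)"
      using ab by (intro mult_right_mono) simp_all
    moreover have "- ((x + y) * y) \<le> x\<^sup>2 / 4"
      using zero_le_power2[of "x / 2 + y"] by (simp add: power2_eq_square algebra_simps)
    ultimately show ?thesis by linarith
  qed
  also have "\<dots> \<le> (3 / 4 * R\<^sup>2 - 1) * d\<^sup>2"
    using x2 by (simp add: field_simps)
  finally show ?thesis by (simp add: a_def b_def d_def)
qed

text \<open>The pointwise estimate is averaged over a probability measure; on the unit sphere the
  integrand of the coupling has norm at most 2, hence is integrable.\<close>

lemma lohe_coupling_diff_le:
  fixes f :: "('d::finite) phase measure"
  assumes \<rho>: "prob_space (state_marginal f)"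
    and n: "norm \<phi>\<^sub>1 = 1" "norm \<phi>\<^sub>2 = 1"
    and R: "AE \<theta> in state_marginal f. norm (\<phi>\<^sub>1 - \<theta>) \<le> R" "AE \<theta> in state_marginal f. norm (\<phi>\<^sub>2 - \<theta>) \<le> R"
  shows "inner (lohe_coupling f \<phi>\<^sub>1 - lohe_coupling f \<phi>\<^sub>2) (\<phi>\<^sub>1 - \<phi>\<^sub>2)
    \<le> (3 / 4 * R\<^sup>2 - 1) * (norm (\<phi>\<^sub>1 - \<phi>\<^sub>2))\<^sup>2"
proof -
  interpret \<rho>: prob_space "state_marginal f" by (rule \<rho>)
  have sp: "norm \<theta> = 1" if "\<theta> \<in> space (state_marginal f)" for \<theta>
    using that by (simp add: state_marginal_def space_restrict_space)
  let ?g = "\<lambda>\<phi> \<theta>. \<theta> - L2_scale (L2_inner \<phi> \<theta>) \<phi>"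
  have int: "integrable (state_marginal f) (?g \<phi>)" if "norm \<phi> = 1" for \<phi>
  proof (rule \<rho>.integrable_const_bound[where B=2])
    show "AE \<theta> in state_marginal f. norm (?g \<phi> \<theta>) \<le> 2"
    proof (rule AE_I2)
      fix \<theta> assume "\<theta> \<in> space (state_marginal f)"
      then have \<theta>: "norm \<theta> = 1" by (rule sp)
      have "norm (?g \<phi> \<theta>) \<le> norm \<theta> + norm (L2_scale (L2_inner \<phi> \<theta>) \<phi>)" by (rule norm_triangle_ineq4)
      also have "\<dots> \<le> 2" using norm_L2_inner_le[of \<phi> \<theta>] that \<theta> by (simp add: norm_L2_scale)
      finally show "norm (?g \<phi> \<theta>) \<le> 2" .
    qed
    have "?g \<phi> \<in> borel_measurable borel"
      by (intro borel_measurable_continuous_onI continuous_intros L2_scale.continuous_on L2_inner.continuous_on)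
    then have "?g \<phi> \<in> borel_measurable (restrict_space borel (sphere 0 1))"
      by (rule measurable_restrict_space1)
    then show "?g \<phi> \<in> borel_measurable (state_marginal f)"
      by (simp add: state_marginal_def)
  qed
  let ?h = "\<lambda>\<theta>. ?g \<phi>\<^sub>1 \<theta> - ?g \<phi>\<^sub>2 \<theta>"
  have inth: "integrable (state_marginal f) ?h"
    by (intro Bochner_Integration.integrable_diff int n)
  have "inner (lohe_coupling f \<phi>\<^sub>1 - lohe_coupling f \<phi>\<^sub>2) (\<phi>\<^sub>1 - \<phi>\<^sub>2)
      = inner (LINT \<theta>|state_marginal f. ?h \<theta>) (\<phi>\<^sub>1 - \<phi>\<^sub>2)"
    unfolding lohe_coupling_def by (subst Bochner_Integration.integral_diff) (simp_all add: int n)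
  also have "\<dots> = (LINT \<theta>|state_marginal f. inner (?h \<theta>) (\<phi>\<^sub>1 - \<phi>\<^sub>2))"
    by (rule integral_inner_left[symmetric]) (rule inth)
  also have "\<dots> \<le> (3 / 4 * R\<^sup>2 - 1) * (norm (\<phi>\<^sub>1 - \<phi>\<^sub>2))\<^sup>2"
  proof (rule \<rho>.integral_le_const)
    show "integrable (state_marginal f) (\<lambda>\<theta>. inner (?h \<theta>) (\<phi>\<^sub>1 - \<phi>\<^sub>2))"
      by (rule integrable_inner_left) (rule inth)
    show "AE \<theta> in state_marginal f. inner (?h \<theta>) (\<phi>\<^sub>1 - \<phi>\<^sub>2) \<le> (3 / 4 * R\<^sup>2 - 1) * (norm (\<phi>\<^sub>1 - \<phi>\<^sub>2))\<^sup>2"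
      using R AE_space by eventually_elim (intro lohe_pointwise n sp)
  qed
  finally show ?thesis .
qed

section \<open>Differential inequalities\<close>

text \<open>Multiplied by the integrating factor \<open>exp (c * t)\<close>, the function
  \<open>u - K\<close> becomes nonincreasing. Derivatives are within \<open>{0..}\<close> because
  characteristics start at time 0; strictly between \<open>a\<close> and \<open>b\<close> they are
  two-sided.\<close>

lemma gronwall_decay:
  fixes u :: "real \<Rightarrow> real"
  assumes "0 \<le> a" "a \<le> b"
    and u: "\<And>t. a \<le> t \<Longrightarrow> t \<le> b \<Longrightarrow> \<exists>D. (u has_real_derivative D) (at t within {0..}) \<and> D \<le> - c * (u t - K)"
  shows "u b - K \<le> (u a - K) * exp (- c * (b - a))"
proof -
  let ?v = "\<lambda>t. (u t - K) * exp (c * t)"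
  have v: "\<exists>D. (?v has_real_derivative D) (at t within {0..}) \<and> D \<le> 0" if t: "a \<le> t" "t \<le> b" for t
  proof -
    obtain D where D: "(u has_real_derivative D) (at t within {0..})" "D \<le> - c * (u t - K)"
      using u[OF t] by blast
    have "(?v has_real_derivative (D + c * (u t - K)) * exp (c * t)) (at t within {0..})"
      by (auto intro!: derivative_eq_intros D(1) simp: algebra_simps)
    moreover have "(D + c * (u t - K)) * exp (c * t) \<le> 0"
      using D(2) by (intro mult_nonpos_nonneg) simp_all
    ultimately show ?thesis by blast
  qed
  have "?v b \<le> ?v a"
  proof (rule DERIV_nonpos_imp_decreasing_open[OF assms(2)])
    fix t assume "a < t" "t < b"
    then show "\<exists>D. (?v has_real_derivative D) (at t) \<and> D \<le> 0"
      using v[of t] assms(1) at_within_interior[of t "{0..}"] by simp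
  next
    show "continuous_on {a..b} ?v"
      unfolding continuous_on_eq_continuous_within
    proof
      fix t assume "t \<in> {a..b}"
      then have "continuous (at t within {0..}) ?v"
        using v[of t] by (auto intro: DERIV_continuous)
      then show "continuous (at t within {a..b}) ?v"
        by (rule continuous_within_subset) (use assms(1) in auto)
    qed
  qed
  then have "(u b - K) * exp (c * b) * exp (- c * b) \<le> (u a - K) * exp (c * a) * exp (- c * b)"
    by (rule mult_right_mono) simp
  then show ?thesis by (simp add: mult.assoc exp_add[symmetric] algebra_simps)
qed

text \<open>This is the decay lemma at rate 0, applied to \<open>u t - C * t\<close>.\<close>

lemma linear_growth:
  fixes u :: "real \<Rightarrow> real"
  assumes "0 \<le> a" "a \<le> b"
    and u: "\<And>t. a \<le> t \<Longrightarrow> t \<le> b \<Longrightarrow> \<exists>D. (u has_real_derivative D) (at t within {0..}) \<and> D \<le> C"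
  shows "u b \<le> u a + C * (b - a)"
proof -
  have "u b - C * b - 0 \<le> (u a - C * a - 0) * exp (- 0 * (b - a))"
  proof (rule gronwall_decay[OF assms(1,2)])
    fix t assume "a \<le> t" "t \<le> b"
    then obtain D where D: "(u has_real_derivative D) (at t within {0..})" "D \<le> C"
      using u by blast
    then show "\<exists>D. ((\<lambda>t. u t - C * t) has_real_derivative D) (at t within {0..}) \<and> D \<le> - 0 * (u t - C * t - 0)"
      by (intro exI[of _ "D - C"]) (auto intro!: derivative_eq_intros)
  qed
  then show ?thesis by (simp add: algebra_simps)
qed

text \<open>The roots are \<open>1 / 8 + r\<close> and \<open>1 / 8 - r\<close>, with
  \<open>r \<le> 1 / 8\<close> because \<open>\<eta> \<ge> 0\<close>. The explicit solution set also
  shows that \<open>Max\<close> is taken over a finite nonempty set.\<close>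

lemma xi2_le:
  assumes "0 \<le> \<eta>" "\<eta> < 1 / 64"
  shows "xi2 \<eta> \<le> 1 / 4"
proof -
  let ?S = "{z :: real. z\<^sup>2 - 1 / 4 * z + \<eta> = 0}"
  define r where "r = sqrt (1 / 64 - \<eta>)"
  have r: "r\<^sup>2 = 1 / 64 - \<eta>" using assms by (simp add: r_def)
  have "(z - (1 / 8 + r)) * (z - (1 / 8 - r)) = z\<^sup>2 - 1 / 4 * z + (1 / 64 - r\<^sup>2)" for z
    by (simp add: power2_eq_square field_simps)
  then have "z\<^sup>2 - 1 / 4 * z + \<eta> = (z - (1 / 8 + r)) * (z - (1 / 8 - r))" for z
    unfolding r by simp
  then have S: "?S = {1 / 8 + r, 1 / 8 - r}" by auto
  have "r \<le> 1 / 8" unfolding r_def by (rule real_le_lsqrt) (use assms in \<open>simp_all add: power2_eq_square\<close>)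
  moreover have "0 \<le> r" using assms by (simp add: r_def)
  ultimately show ?thesis unfolding xi2_def S by simp
qed

section \<open>Characteristics\<close>

lemma fst_measurable:
  "fst \<in> restrict_space borel (phase_space :: ('d::finite) phase set) \<rightarrow>\<^sub>M restrict_space borel (sphere 0 1)"
proof (rule measurable_restrict_space2)
  have "fst \<in> (borel :: 'd phase measure) \<rightarrow>\<^sub>M borel"
    by (intro borel_measurable_continuous_onI continuous_intros)
  then show "fst \<in> restrict_space borel (phase_space :: 'd phase set) \<rightarrow>\<^sub>M borel"
    by (rule measurable_restrict_space1)
qed (auto simp: space_restrict_space phase_space_def)

text \<open>The marginal lives on the unit sphere; boundedness makes the supremum in
  \<open>diameter\<close> a genuine one.\<close>

lemma bounded_state_support: "bounded (measure_support (state_marginal g))"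
  by (rule boundedI[where B=1]) (simp add: measure_support_def state_marginal_def space_restrict_space)

lemma state_diameter_nonneg: "0 \<le> state_diameter g"
  unfolding state_diameter_def by (rule diameter_ge_0[OF bounded_state_support])

lemma Limsup_state_diameter_nonneg: "0 \<le> Limsup at_top (\<lambda>t :: real. ereal (state_diameter (f t)))"
  by (rule le_Limsup) (simp_all add: state_diameter_nonneg)

text \<open>A single coupling strength with a chosen flow. \<open>spread\<close> is the pointwise
  form of the potential spread, multiplied by \<open>hbar\<close>.\<close>

locale lohe_flow =
  fixes hbar \<kappa> \<alpha> :: real and f\<^sub>0 :: "('d::finite) phase measure"
    and f :: "real \<Rightarrow> 'd phase measure" and \<Phi> :: "real \<Rightarrow> 'd phase \<Rightarrow> 'd L2"
  assumes hbar: "hbar > 0" and \<kappa>: "\<kappa> > 0"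
    and f0: "f\<^sub>0 \<in> borel_probabilities phase_space"
    and flow: "characteristic_flow hbar \<kappa> f \<Phi>"
    and transport_measurable: "\<And>t. t \<ge> 0 \<Longrightarrow> (\<lambda>(\<phi>\<^sub>0, V). (\<Phi> t (\<phi>\<^sub>0, V), V))
          \<in> restrict_space borel phase_space \<rightarrow>\<^sub>M restrict_space borel phase_space"
    and transport: "\<And>t. t \<ge> 0 \<Longrightarrow>
          f t = distr f\<^sub>0 (restrict_space borel phase_space) (\<lambda>(\<phi>\<^sub>0, V). (\<Phi> t (\<phi>\<^sub>0, V), V))"
    and spread: "\<And>z w. z \<in> measure_support f\<^sub>0 \<Longrightarrow> w \<in> measure_support f\<^sub>0 \<Longrightarrow>
          norm (snd z - snd w) \<le> hbar * \<alpha>"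
begin

section \<open>The initial support and its transport\<close>

abbreviation S :: "'d phase set" where "S \<equiv> measure_support f\<^sub>0"

abbreviation transport_map :: "real \<Rightarrow> 'd phase \<Rightarrow> 'd phase"
  where "transport_map t \<equiv> (\<lambda>(\<phi>\<^sub>0, V). (\<Phi> t (\<phi>\<^sub>0, V), V))"

lemma prob_space_f0: "prob_space f\<^sub>0"
  and sets_f0: "sets f\<^sub>0 = sets (restrict_space borel phase_space)"
  using f0 by (simp_all add: borel_probabilities_def)

lemma space_f0: "space f\<^sub>0 = phase_space"
  using sets_eq_imp_space_eq[OF sets_f0] by (simp add: space_restrict_space)

lemma S_subset: "S \<subseteq> phase_space"
  by (auto simp: measure_support_def space_f0)

lemma AE_S: "AE z in f\<^sub>0. z \<in> S"
  using countable_dense_phase AE_in_measure_support[OF _ _ sets_f0] by blast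

text \<open>A probability measure carried by \<open>S\<close> forces \<open>S\<close> to be
  nonempty; a point compared with itself then gives the sign.\<close>

lemma spread_nonneg: "0 \<le> \<alpha>"
proof -
  interpret prob_space f\<^sub>0 by (rule prob_space_f0)
  have "S \<noteq> {}"
  proof
    assume "S = {}"
    then have "AE z in f\<^sub>0. False" using AE_S by simp
    then show False by simp
  qed
  then obtain z where "z \<in> S" by blast
  from spread[OF this this] show ?thesis using hbar by (simp add: zero_le_mult_iff)
qed

text \<open>Conservation of the norm is read off from the codomain of the transport map, whose first
  component is the unit sphere.\<close>

lemma norm_flow:
  assumes "t \<ge> 0" "z \<in> phase_space"
  shows "norm (\<Phi> t z) = 1"
proof -
  have "transport_map t z \<in> phase_space"
    using measurable_space[OF transport_measurable[OF assms(1)]] assms(2)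
    by (simp add: space_restrict_space)
  then show ?thesis by (cases z) (simp add: phase_space_def)
qed

lemma flow_measurable:
  assumes "t \<ge> 0"
  shows "\<Phi> t \<in> f\<^sub>0 \<rightarrow>\<^sub>M restrict_space borel (sphere 0 1)"
proof -
  have "(\<lambda>z. fst (transport_map t z)) \<in> restrict_space borel phase_space \<rightarrow>\<^sub>M restrict_space borel (sphere 0 1)"
    by (rule measurable_compose[OF transport_measurable[OF assms] fst_measurable])
  moreover have "(\<lambda>z. fst (transport_map t z)) = \<Phi> t" by (simp add: fun_eq_iff)
  ultimately show ?thesis
    by (simp add: measurable_cong_sets[OF sets_f0 refl])
qed

lemma state_marginal_eq:
  assumes "t \<ge> 0"
  shows "state_marginal (f t) = distr f\<^sub>0 (restrict_space borel (sphere 0 1)) (\<Phi> t)"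
proof -
  have "transport_map t \<in> f\<^sub>0 \<rightarrow>\<^sub>M restrict_space borel phase_space"
    using transport_measurable[OF assms] by (simp add: measurable_cong_sets[OF sets_f0 refl])
  then show ?thesis
    unfolding state_marginal_def transport[OF assms]
    by (subst distr_distr[OF fst_measurable]) (simp_all add: comp_def case_prod_unfold)
qed

text \<open>\<open>S\<close> has full initial measure and the marginal is its image under
  \<open>\<Phi> t\<close>, so statements about characteristics from \<open>S\<close> become almost
  sure ones; closedness makes \<open>C\<close> measurable.\<close>

lemma AE_state_marginal:
  assumes t: "t \<ge> 0" and C: "closed C" and S: "\<And>z. z \<in> S \<Longrightarrow> \<Phi> t z \<in> C"
  shows "AE \<theta> in state_marginal (f t). \<theta> \<in> C"
proof -
  have "{\<theta> \<in> space (restrict_space borel (sphere 0 1)). \<theta> \<in> C} \<in> sets (restrict_space borel (sphere 0 1))"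
    using C by (auto simp: sets_restrict_space space_restrict_space intro!: image_eqI[of _ _ C])
  then show ?thesis
    unfolding state_marginal_eq[OF t]
    by (subst AE_distr_iff[OF flow_measurable[OF t]]) (use AE_S S in \<open>auto elim: eventually_mono\<close>)
qed

text \<open>The support of the marginal lies in the closure of the image of \<open>S\<close>, and
  taking the closure does not change the diameter.\<close>

lemma state_diameter_le:
  assumes t: "t \<ge> 0" and "0 \<le> r" and r: "\<And>z w. z \<in> S \<Longrightarrow> w \<in> S \<Longrightarrow> norm (\<Phi> t z - \<Phi> t w) \<le> r"
  shows "state_diameter (f t) \<le> r"
proof -
  let ?C = "closure (\<Phi> t ` S)"
  have "measure_support (state_marginal (f t)) \<subseteq> ?C"
  proof (rule measure_support_subset_closed)
    show "AE \<theta> in state_marginal (f t). \<theta> \<in> ?C"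
      by (rule AE_state_marginal[OF t]) (use closure_subset[of "\<Phi> t ` S"] in auto)
  qed (simp_all add: state_marginal_def)
  moreover have b: "bounded (\<Phi> t ` S)"
    by (rule boundedI[where B=1]) (use norm_flow[OF t] S_subset in auto)
  ultimately have "state_diameter (f t) \<le> diameter ?C"
    unfolding state_diameter_def by (intro diameter_subset bounded_closure)
  also have "\<dots> \<le> r"
    unfolding diameter_closure[OF b] by (rule diameter_le) (use r \<open>0 \<le> r\<close> in auto)
  finally show ?thesis .
qed

text \<open>Points of \<open>S\<close> project into the support of the marginal, since a
  neighbourhood \<open>U\<close> of the projection has the open preimage
  \<open>U \<times> UNIV\<close>.\<close>

lemma initial_distance_le:
  assumes "z \<in> S" "w \<in> S"
  shows "norm (\<Phi> 0 z - \<Phi> 0 w) \<le> state_diameter f\<^sub>0"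
proof -
  have m: "fst \<in> f\<^sub>0 \<rightarrow>\<^sub>M restrict_space borel (sphere 0 1)"
    using fst_measurable by (simp add: measurable_cong_sets[OF sets_f0 refl])
  have *: "fst y \<in> measure_support (state_marginal f\<^sub>0)" "\<Phi> 0 y = fst y" if y: "y \<in> S" for y
  proof -
    have sph: "fst y \<in> sphere 0 1" using y S_subset by (auto simp: phase_space_def)
    have "0 < emeasure (state_marginal f\<^sub>0) (U \<inter> space (state_marginal f\<^sub>0))" if U: "open U" "fst y \<in> U" for U
    proof -
      have "U \<inter> sphere 0 1 \<in> sets (restrict_space borel (sphere 0 1))"
        using U(1) by (auto simp: sets_restrict_space intro!: image_eqI[of _ _ U])
      then have "emeasure (state_marginal f\<^sub>0) (U \<inter> sphere 0 1) = emeasure f\<^sub>0 (fst -` (U \<inter> sphere 0 1) \<inter> space f\<^sub>0)"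
        unfolding state_marginal_def by (rule emeasure_distr[OF m])
      moreover have "fst -` (U \<inter> sphere 0 1) \<inter> space f\<^sub>0 = (U \<times> UNIV) \<inter> space f\<^sub>0"
        by (auto simp: space_f0 phase_space_def)
      moreover have "0 < emeasure f\<^sub>0 ((U \<times> UNIV) \<inter> space f\<^sub>0)"
        using y U open_Times[OF U(1) open_UNIV] by (auto simp: measure_support_def mem_Times_iff)
      ultimately show ?thesis by (simp add: state_marginal_def space_restrict_space)
    qed
    then show "fst y \<in> measure_support (state_marginal f\<^sub>0)"
      using sph by (simp add: measure_support_def state_marginal_def space_restrict_space)
    show "\<Phi> 0 y = fst y"
      using flow y S_subset by (cases y) (auto simp: characteristic_flow_def)
  qed
  from diameter_bounded_bound[OF bounded_state_support *(1)[OF assms(1)] *(1)[OF assms(2)]]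
  show ?thesis
    unfolding state_diameter_def by (simp add: *(2) assms dist_norm)
qed

section \<open>Differential inequalities for squared distances\<close>

definition sqdist :: "'d phase \<Rightarrow> 'd phase \<Rightarrow> real \<Rightarrow> real"
  where "sqdist z w t = (norm (\<Phi> t z - \<Phi> t w))\<^sup>2"

text \<open>The square is differentiable even where two characteristics meet. Its derivative is
  \<open>2 * inner v' v\<close>, in which the free field and the coupling are bounded
  separately.\<close>

lemma sqdist_derivative:
  assumes z: "z \<in> S" and w: "w \<in> S" and t: "t \<ge> 0"
    and R: "\<And>y y'. y \<in> S \<Longrightarrow> y' \<in> S \<Longrightarrow> norm (\<Phi> t y - \<Phi> t y') \<le> R"
  shows "\<exists>D. (sqdist z w has_real_derivative D) (at t within {0..}) \<and>
    D \<le> 2 * \<alpha> * norm (\<Phi> t z - \<Phi> t w) + \<kappa> * (3 / 4 * R\<^sup>2 - 1) * sqdist z w t"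
proof -
  define X where "X y = free_field hbar t (\<Phi> t y) (snd y)" for y
  define Y where "Y y = lohe_coupling (f t) (\<Phi> t y)" for y
  define v where "v = \<Phi> t z - \<Phi> t w"
  define v' where "v' = (X z + (\<kappa> / 2) *\<^sub>R Y z) - (X w + (\<kappa> / 2) *\<^sub>R Y w)"
  have ode: "((\<lambda>s. \<Phi> s y) has_vector_derivative (X y + (\<kappa> / 2) *\<^sub>R Y y)) (at t within {0..})" if "y \<in> S" for y
    using flow that S_subset t by (cases y) (auto simp: characteristic_flow_def X_def Y_def)
  have v: "((\<lambda>s. \<Phi> s z - \<Phi> s w) has_vector_derivative v') (at t within {0..})"
    unfolding v'_def by (intro has_vector_derivative_diff ode z w)
  have "((\<lambda>s. inner (\<Phi> s z - \<Phi> s w) (\<Phi> s z - \<Phi> s w)) has_vector_derivative (inner v v' + inner v' v)) (at t within {0..})"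
    unfolding v_def by (rule bounded_bilinear.has_vector_derivative[OF bounded_bilinear_inner v v])
  then have deriv: "(sqdist z w has_real_derivative 2 * inner v' v) (at t within {0..})"
    unfolding has_real_derivative_iff_has_vector_derivative
    by (simp add: sqdist_def[abs_def] power2_norm_eq_inner inner_commute[of v])
  have n: "norm (\<Phi> t y) = 1" if "y \<in> S" for y
    using norm_flow[OF t] S_subset that by blast
  have "inner (X z - X w) v \<le> norm (snd z - snd w) / hbar * norm (\<Phi> t w) * norm v"
    unfolding X_def v_def by (rule inner_free_field_diff_le[OF hbar])
  also have "\<dots> \<le> \<alpha> * norm v"
  proof -
    have "norm (snd z - snd w) / hbar \<le> \<alpha>"
      using spread[OF z w] hbar by (simp add: field_simps)
    from mult_right_mono[OF this norm_ge_zero[of v]] show ?thesis by (simp add: n[OF w])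
  qed
  finally have X: "inner (X z - X w) v \<le> \<alpha> * norm v" .
  interpret f0: prob_space f\<^sub>0 by (rule prob_space_f0)
  have prob: "prob_space (state_marginal (f t))"
    unfolding state_marginal_eq[OF t] by (rule f0.prob_space_distr[OF flow_measurable[OF t]])
  \<comment> \<open>All characteristics from \<open>S\<close> lie in the closed ball of radius
    \<open>R\<close> around \<open>\<Phi> t y\<close>, so the marginal is concentrated
    there.\<close>
  have ae: "AE \<theta> in state_marginal (f t). norm (\<Phi> t y - \<theta>) \<le> R" if "y \<in> S" for y
    using AE_state_marginal[OF t closed_cball, of "\<Phi> t y" R] R that by (simp add: dist_norm)
  have Y: "inner (Y z - Y w) v \<le> (3 / 4 * R\<^sup>2 - 1) * (norm v)\<^sup>2"
    unfolding Y_def v_def by (intro lohe_coupling_diff_le prob n ae z w)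
  have "2 * inner v' v = 2 * inner (X z - X w) v + \<kappa> * inner (Y z - Y w) v"
    unfolding v'_def by (simp add: inner_diff_left inner_add_left algebra_simps)
  also have "\<dots> \<le> 2 * (\<alpha> * norm v) + \<kappa> * ((3 / 4 * R\<^sup>2 - 1) * (norm v)\<^sup>2)"
    using X Y \<kappa> by (intro add_mono mult_left_mono) simp_all
  finally have "2 * inner v' v \<le> 2 * \<alpha> * norm v + \<kappa> * (3 / 4 * R\<^sup>2 - 1) * (norm v)\<^sup>2"
    by (simp only: mult.assoc)
  then show ?thesis
    unfolding v_def[symmetric] using deriv by (intro exI[of _ "2 * inner v' v"]) (simp add: sqdist_def v_def)
qed

text \<open>At \<open>R = 1 / 2\<close> the coupling contributes the rate
  \<open>- 13 / 16 * \<kappa>\<close>. Absorbing the linear term costs \<open>\<kappa> / 2\<close>,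
  and the remaining \<open>- 5 / 16\<close> is weakened to \<open>- 1 / 4\<close>. Dividing the
  leftover \<open>2 * \<alpha>\<^sup>2 / \<kappa>\<close> by \<open>\<kappa> / 4\<close> gives the
  level \<open>8 * (\<alpha> / \<kappa>)\<^sup>2\<close>.\<close>

lemma sqdist_decay_rate:
  assumes z: "z \<in> S" and w: "w \<in> S" and t: "t \<ge> 0"
    and R: "\<And>y y'. y \<in> S \<Longrightarrow> y' \<in> S \<Longrightarrow> norm (\<Phi> t y - \<Phi> t y') \<le> 1 / 2"
  shows "\<exists>D. (sqdist z w has_real_derivative D) (at t within {0..}) \<and>
    D \<le> - (\<kappa> / 4) * (sqdist z w t - 8 * (\<alpha> / \<kappa>)\<^sup>2)"
proof -
  let ?d = "norm (\<Phi> t z - \<Phi> t w)"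
  obtain D where D: "(sqdist z w has_real_derivative D) (at t within {0..})"
    "D \<le> 2 * \<alpha> * ?d + \<kappa> * (3 / 4 * (1 / 2)\<^sup>2 - 1) * sqdist z w t"
    using sqdist_derivative[OF z w t R] by blast
  have "2 * \<alpha> * ?d \<le> \<kappa> / 2 * ?d\<^sup>2 + 2 * \<alpha>\<^sup>2 / \<kappa>"
  proof -
    have "0 \<le> \<kappa> / 2 * (?d - 2 * \<alpha> / \<kappa>)\<^sup>2" using \<kappa> by simp
    also have "\<dots> = \<kappa> / 2 * ?d\<^sup>2 + 2 * \<alpha>\<^sup>2 / \<kappa> - 2 * \<alpha> * ?d"
      using \<kappa> by (simp add: power2_eq_square field_simps)
    finally show ?thesis by simp
  qed
  with D(2) have "D \<le> - (5 / 16) * (\<kappa> * ?d\<^sup>2) + 2 * \<alpha>\<^sup>2 / \<kappa>"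
    by (simp add: sqdist_def power2_eq_square)
  also have "\<dots> \<le> - (1 / 4) * (\<kappa> * ?d\<^sup>2) + 2 * \<alpha>\<^sup>2 / \<kappa>"
    using \<kappa> by (intro add_right_mono mult_right_mono) simp_all
  also have "\<dots> = - (\<kappa> / 4) * (sqdist z w t - 8 * (\<alpha> / \<kappa>)\<^sup>2)"
    using \<kappa> by (simp add: sqdist_def power2_eq_square field_simps)
  finally show ?thesis using D(1) by blast
qed

text \<open>On the unit sphere \<open>R = 2\<close> is always admissible, which bounds the
  derivative by \<open>2 * \<alpha> * 2 + \<kappa> * 2 * 4\<close>, uniformly over all
  pairs.\<close>

lemma sqdist_growth:
  assumes z: "z \<in> S" and w: "w \<in> S" and "0 \<le> a" "a \<le> b"
  shows "sqdist z w b \<le> sqdist z w a + (4 * \<alpha> + 8 * \<kappa>) * (b - a)"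
proof (rule linear_growth[OF assms(3,4)])
  fix t assume "a \<le> t" "t \<le> b"
  then have t: "t \<ge> 0" using \<open>0 \<le> a\<close> by simp
  have two: "norm (\<Phi> t y - \<Phi> t y') \<le> 2" if "y \<in> S" "y' \<in> S" for y y'
    using norm_triangle_ineq4[of "\<Phi> t y" "\<Phi> t y'"] norm_flow[OF t subsetD[OF S_subset that(1)]]
      norm_flow[OF t subsetD[OF S_subset that(2)]]
    by simp
  obtain D where D: "(sqdist z w has_real_derivative D) (at t within {0..})"
    "D \<le> 2 * \<alpha> * norm (\<Phi> t z - \<Phi> t w) + \<kappa> * (3 / 4 * 2\<^sup>2 - 1) * sqdist z w t"
    using sqdist_derivative[OF z w t two] by blast
  have "2 * \<alpha> * norm (\<Phi> t z - \<Phi> t w) \<le> 2 * \<alpha> * 2"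
    using two[OF z w] spread_nonneg by (intro mult_left_mono) simp_all
  moreover have "sqdist z w t \<le> 4"
    using power_mono[OF two[OF z w] norm_ge_zero, of 2] by (simp add: sqdist_def)
  then have "\<kappa> * (3 / 4 * 2\<^sup>2 - 1) * sqdist z w t \<le> \<kappa> * 2 * 4"
    using \<kappa> by simp
  ultimately have "D \<le> 4 * \<alpha> + 8 * \<kappa>" using D(2) by linarith
  then show "\<exists>D. (sqdist z w has_real_derivative D) (at t within {0..}) \<and> D \<le> 4 * \<alpha> + 8 * \<kappa>"
    using D(1) by blast
qed

section \<open>Trapping and decay for strong coupling\<close>

context
  assumes coupling: "64 * \<alpha> < \<kappa>" and init: "state_diameter f\<^sub>0 \<le> 1 / 4"
begin

text \<open>The level towards which squared distances decay stays below the trapping level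
  \<open>(1 / 4)\<^sup>2\<close>.\<close>

lemma equilibrium_le: "8 * (\<alpha> / \<kappa>)\<^sup>2 \<le> 1 / 16"
proof -
  have "(\<alpha> / \<kappa>)\<^sup>2 \<le> (1 / 64)\<^sup>2"
    using coupling \<kappa> spread_nonneg by (intro power_mono) (simp_all add: field_simps)
  also have "\<dots> \<le> 1 / 128" by (simp add: power2_eq_square)
  finally show ?thesis by simp
qed

text \<open>The crude growth bound keeps the diameter below $1/2$ for a time that does not depend on the
  starting point; as long as it is below $1/2$, the decay rate keeps it below $1/4$.\<close>

lemma sqdist_trap:
  assumes "z \<in> S" "w \<in> S" "t \<ge> 0"
  shows "sqdist z w t \<le> 1 / 16"
proof -
  \<comment> \<open>Within time \<open>h\<close> the growth bound adds at most
    \<open>3 / 16\<close>, which takes a squared distance from at most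
    \<open>(1 / 4)\<^sup>2\<close> to at most \<open>(1 / 2)\<^sup>2\<close>.\<close>
  define h where "h = 3 / 16 / (4 * \<alpha> + 8 * \<kappa>)"
  have c: "4 * \<alpha> + 8 * \<kappa> > 0" using \<kappa> spread_nonneg by simp
  then have "h > 0" by (simp add: h_def)
  have h2: "(4 * \<alpha> + 8 * \<kappa>) * h = 3 / 16"
  proof -
    have "x * (3 / 16 / x) = 3 / 16" if "x > 0" for x :: real using that by simp
    from this[OF c] show ?thesis by (simp only: h_def)
  qed
  note h = \<open>h > 0\<close> this
  \<comment> \<open>The bound at time \<open>a\<close> is assumed for all pairs at once, because the
    decay rate of one pair requires every pair to be within distance \<open>1 / 2\<close>.\<close>
  have step: "sqdist z w t \<le> 1 / 16"
    if a: "a \<ge> 0" "\<And>z w. z \<in> S \<Longrightarrow> w \<in> S \<Longrightarrow> sqdist z w a \<le> 1 / 16"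
      and t: "a \<le> t" "t \<le> a + h" and zw: "z \<in> S" "w \<in> S" for a t z w
  proof -
    have half: "norm (\<Phi> s y - \<Phi> s y') \<le> 1 / 2" if s: "a \<le> s" "s \<le> t" and y: "y \<in> S" "y' \<in> S" for s y y'
    proof (rule power2_le_imp_le)
      have "(4 * \<alpha> + 8 * \<kappa>) * (s - a) \<le> (4 * \<alpha> + 8 * \<kappa>) * h"
        using s t c by (intro mult_left_mono) simp_all
      then have "sqdist y y' s \<le> 1 / 16 + 3 / 16"
        using sqdist_growth[OF y a(1) s(1)] a(2)[OF y] h(2) by linarith
      then show "(norm (\<Phi> s y - \<Phi> s y'))\<^sup>2 \<le> (1 / 2)\<^sup>2"
        by (simp add: sqdist_def power2_eq_square)
    qed simp
    have "sqdist z w t - 8 * (\<alpha> / \<kappa>)\<^sup>2 \<le> (sqdist z w a - 8 * (\<alpha> / \<kappa>)\<^sup>2) * exp (- (\<kappa> / 4) * (t - a))"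
      by (rule gronwall_decay[OF a(1) t(1)], rule sqdist_decay_rate[OF zw]) (use a(1) half in auto)
    also have "\<dots> \<le> (1 / 16 - 8 * (\<alpha> / \<kappa>)\<^sup>2) * exp (- (\<kappa> / 4) * (t - a))"
      using a(2)[OF zw] by (intro mult_right_mono) simp_all
    \<comment> \<open>The first factor is nonnegative by \<open>equilibrium_le\<close>, so the
      exponential may be replaced by 1.\<close>
    also have "\<dots> \<le> (1 / 16 - 8 * (\<alpha> / \<kappa>)\<^sup>2) * 1"
      using equilibrium_le \<kappa> t(1) by (intro mult_left_mono) simp_all
    finally show ?thesis by simp
  qed
  \<comment> \<open>Induction over time slabs of length \<open>h\<close>; the pair stays arbitrary,
    since each slab starts from the bound for all pairs at the end of the previous one.\<close>
  have trap: "sqdist z w t \<le> 1 / 16" if "z \<in> S" "w \<in> S" "0 \<le> t" "t \<le> real n * h" for n t z w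
    using that
  proof (induction n arbitrary: t z w)
    case 0
    have "(norm (\<Phi> 0 z - \<Phi> 0 w))\<^sup>2 \<le> (1 / 4)\<^sup>2"
      using initial_distance_le[OF 0(1,2)] init by (intro power_mono) simp_all
    then show ?case using 0 by (simp add: sqdist_def power2_eq_square)
  next
    case (Suc n)
    show ?case
    proof (cases "t \<le> real n * h")
      case False
      show ?thesis
      proof (rule step[of "real n * h"])
        show "sqdist z' w' (real n * h) \<le> 1 / 16" if "z' \<in> S" "w' \<in> S" for z' w'
          using Suc.IH[OF that] h(1) by simp
      qed (use False Suc.prems h(1) in \<open>simp_all add: algebra_simps\<close>)
    qed (use Suc in auto)
  qed
  obtain n where "t < real n * h" using h(1) reals_Archimedean3 by blast
  then show ?thesis by (intro trap[OF assms] less_imp_le)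
qed

text \<open>The trap makes the decay rate valid at all times, so the decay lemma applies once, from
  time 0.\<close>

lemma sqdist_decay:
  assumes "z \<in> S" "w \<in> S" "t \<ge> 0"
  shows "sqdist z w t \<le> 8 * (\<alpha> / \<kappa>)\<^sup>2 + exp (- (\<kappa> / 4) * t) / 16"
proof -
  have half: "norm (\<Phi> s y - \<Phi> s y') \<le> 1 / 2" if "0 \<le> s" "y \<in> S" "y' \<in> S" for s y y'
    by (rule power2_le_imp_le)
      (use sqdist_trap[OF that(2,3,1)] in \<open>simp_all add: sqdist_def power2_eq_square\<close>)
  have "sqdist z w t - 8 * (\<alpha> / \<kappa>)\<^sup>2 \<le> (sqdist z w 0 - 8 * (\<alpha> / \<kappa>)\<^sup>2) * exp (- (\<kappa> / 4) * (t - 0))"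
    by (rule gronwall_decay[OF order_refl assms(3)], rule sqdist_decay_rate[OF assms(1,2)]) (use half in auto)
  also have "\<dots> \<le> 1 / 16 * exp (- (\<kappa> / 4) * (t - 0))"
  proof (intro mult_right_mono)
    have "0 \<le> (\<alpha> / \<kappa>)\<^sup>2" by simp
    then show "sqdist z w 0 - 8 * (\<alpha> / \<kappa>)\<^sup>2 \<le> 1 / 16"
      using sqdist_trap[OF assms(1,2) order_refl] by linarith
  qed simp
  finally show ?thesis by simp
qed

text \<open>The bound is uniform over pairs and so passes to the diameter; the exponential vanishes
  as time grows, and \<open>\<alpha> \<ge> 0\<close> allows extracting the root.\<close>

lemma Limsup_state_diameter_le:
  "Limsup at_top (\<lambda>t. ereal (state_diameter (f t))) \<le> ereal (sqrt 8 * \<alpha> / \<kappa>)"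
proof -
  let ?g = "\<lambda>t. sqrt (8 * (\<alpha> / \<kappa>)\<^sup>2 + exp (- (\<kappa> / 4) * t) / 16)"
  have "\<forall>\<^sub>F t in at_top. ereal (state_diameter (f t)) \<le> ereal (?g t)"
    using eventually_ge_at_top[of 0]
  proof eventually_elim
    case (elim t)
    have "norm (\<Phi> t z - \<Phi> t w) \<le> ?g t" if "z \<in> S" "w \<in> S" for z w
      using sqdist_decay[OF that elim] by (intro real_le_rsqrt) (simp add: sqdist_def)
    then show ?case by (simp add: state_diameter_le[OF elim] add_nonneg_nonneg)
  qed
  then have "Limsup at_top (\<lambda>t. ereal (state_diameter (f t))) \<le> Limsup at_top (\<lambda>t. ereal (?g t))"
    by (rule Limsup_mono)
  also have "\<dots> = ereal (sqrt 8 * \<alpha> / \<kappa>)"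
  proof (rule lim_imp_Limsup)
    have "filterlim (\<lambda>t. - (\<kappa> / 4) * t) at_bot at_top"
      by (rule filterlim_tendsto_neg_mult_at_bot[OF tendsto_const _ filterlim_ident]) (use \<kappa> in simp)
    then have "((\<lambda>t. exp (- (\<kappa> / 4) * t)) \<longlongrightarrow> 0) at_top"
      by (rule filterlim_compose[OF exp_at_bot])
    then have "(?g \<longlongrightarrow> sqrt (8 * (\<alpha> / \<kappa>)\<^sup>2 + 0 / 16)) at_top"
      by (intro tendsto_intros) simp_all
    moreover have "sqrt (8 * (\<alpha> / \<kappa>)\<^sup>2 + 0 / 16) = sqrt 8 * \<alpha> / \<kappa>"
      using spread_nonneg \<kappa> by (simp add: real_sqrt_mult)
    ultimately show "((\<lambda>t. ereal (?g t)) \<longlongrightarrow> ereal (sqrt 8 * \<alpha> / \<kappa>)) at_top"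
      by (simp only: tendsto_ereal)
  qed simp
  finally show ?thesis .
qed

end

end

section \<open>Practical synchronization\<close>

theorem theorem6p1:
  fixes hbar \<alpha> :: real
    and f :: "real \<Rightarrow> real \<Rightarrow> ('d::finite) phase measure"
    and f\<^sub>0 :: "real \<Rightarrow> 'd phase measure"
  assumes "hbar > 0"
    and "\<And>\<kappa>. \<kappa> > 0 \<Longrightarrow> schroedinger_lohe_solution hbar \<kappa> (f\<^sub>0 \<kappa>) (f \<kappa>)"
    and "potential_bound f\<^sub>0 < \<infinity>"
    and "potential_spread hbar f\<^sub>0 = ereal \<alpha>"
    and "\<And>\<kappa>. \<kappa> > 0 \<Longrightarrow> \<kappa> > 64 * \<alpha> \<Longrightarrow> state_diameter (f\<^sub>0 \<kappa>) < xi2 (\<alpha> / \<kappa>)"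
  shows "((\<lambda>\<kappa>. Limsup at_top (\<lambda>t. ereal (state_diameter (f \<kappa> t)))) \<longlongrightarrow> 0) at_top"
proof -
  \<comment> \<open>The nested suprema dominate each single pair of support points, and
    multiplication by the nonnegative \<open>1 / hbar\<close> preserves the order of extended
    reals.\<close>
  have spread: "norm (snd z - snd w) \<le> hbar * \<alpha>"
    if "\<kappa> > 0" and z: "z \<in> measure_support (f\<^sub>0 \<kappa>)" and w: "w \<in> measure_support (f\<^sub>0 \<kappa>)" for \<kappa> z w
  proof -
    let ?F = "\<lambda>((\<phi>\<^sub>1, V\<^sub>1), (\<phi>\<^sub>2, V\<^sub>2)). ereal (norm (V\<^sub>1 - V\<^sub>2))"
    let ?s = "SUP \<kappa>\<in>{0<..}. SUP p\<in>measure_support (f\<^sub>0 \<kappa>) \<times> measure_support (f\<^sub>0 \<kappa>). ?F p"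
    have "?F (z, w) \<le> (SUP p\<in>measure_support (f\<^sub>0 \<kappa>) \<times> measure_support (f\<^sub>0 \<kappa>). ?F p)"
      by (rule SUP_upper) (use z w in simp)
    also have "\<dots> \<le> ?s" by (rule SUP_upper) (use that(1) in simp)
    finally have "ereal (1 / hbar) * ereal (norm (snd z - snd w)) \<le> ereal (1 / hbar) * ?s"
      using assms(1) by (intro ereal_mult_left_mono) (simp_all add: case_prod_unfold)
    also have "\<dots> = ereal \<alpha>" using assms(4) unfolding potential_spread_def .
    finally show ?thesis using assms(1) by (simp add: field_simps)
  qed
  have flow: "\<exists>\<Phi>. lohe_flow hbar \<kappa> \<alpha> (f\<^sub>0 \<kappa>) (f \<kappa>) \<Phi>" if "\<kappa> > 0" for \<kappa>
    using assms(2)[OF that] assms(1) that spread[OF that]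
    unfolding schroedinger_lohe_solution_def lohe_flow_def by blast
  have bounds: "0 \<le> Limsup at_top (\<lambda>t. ereal (state_diameter (f \<kappa> t))) \<and>
      Limsup at_top (\<lambda>t. ereal (state_diameter (f \<kappa> t))) \<le> ereal (sqrt 8 * \<alpha> / \<kappa>)"
    if large: "\<kappa> > 0" "\<kappa> > 64 * \<alpha>" for \<kappa>
  proof -
    obtain \<Phi> where "lohe_flow hbar \<kappa> \<alpha> (f\<^sub>0 \<kappa>) (f \<kappa>) \<Phi>" using flow[OF large(1)] by blast
    then interpret lohe_flow hbar \<kappa> \<alpha> "f\<^sub>0 \<kappa>" "f \<kappa>" \<Phi> .
    \<comment> \<open>The initial condition enters through this bound, which supplies the
      \<open>1 / 4\<close> from which the trap starts.\<close>
    have "xi2 (\<alpha> / \<kappa>) \<le> 1 / 4"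
      using large spread_nonneg by (intro xi2_le) (simp_all add: field_simps)
    then have "state_diameter (f\<^sub>0 \<kappa>) \<le> 1 / 4" using assms(5)[OF large] by simp
    then show ?thesis using Limsup_state_diameter_le[OF large(2)] Limsup_state_diameter_nonneg by simp
  qed
  have ev: "\<forall>\<^sub>F \<kappa> in at_top. \<kappa> > 0 \<and> \<kappa> > 64 * \<alpha>"
    by (intro eventually_conj eventually_gt_at_top)
  \<comment> \<open>The limit superior is squeezed between 0 and this vanishing bound.\<close>
  have "((\<lambda>\<kappa>. ereal (sqrt 8 * \<alpha> / \<kappa>)) \<longlongrightarrow> ereal 0) at_top"
    by (intro tendsto_ereal tendsto_divide_0[OF tendsto_const] filterlim_at_top_imp_at_infinity filterlim_ident)
  then have "((\<lambda>\<kappa>. ereal (sqrt 8 * \<alpha> / \<kappa>)) \<longlongrightarrow> 0) at_top"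
    by (simp only: zero_ereal_def)
  then show ?thesis
    by (rule tendsto_sandwich[OF _ _ tendsto_const, rotated 2]) (use ev bounds in \<open>auto elim: eventually_mono\<close>)
qed

end
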